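(* Let $p,q\ge 1$ be integers and let $v$ be a non-zero element of $\mathbb{C}^{p+q}$. Then the complex $(p+q)$-dimensional vector space $$\mathcal{E}_v=\{\phi_a:\mathrm{SU}(p,q)\to\mathbb{C}\mid \phi_a(z)=\operatorname{trace}(v^t a z^t),\ a\in\mathbb{C}^{p+q}\}$$ is an eigenfamily on the semi-Riemannian Lie group $\mathrm{SU}(p,q)$ such that for all $\phi,\psi\in\mathcal{E}_v$ we have $$\tau(\phi)=-\frac{(p+q)^2-1}{p+q}\cdot\phi,\qquad\kappa(\phi,\psi)=-\frac{p+q-1}{p+q}\cdot\phi\cdot\psi.$$
   Context: Elements of $\mathbb{C}^{p+q}$ are row vectors, so $v^ta$ is the matrix $(v_ja_\alpha)_{j\alpha}$. Let $I_{p,q}=\begin{bmatrix}-I_p&0\\0&I_q\end{bmatrix}$ and let $z^*=\bar z^t$. The group is $\mathrm{SU}(p,q)=\{z\in\mathrm{SL}_{p+q}(\mathbb{C})\mid zI_{p,q}z^*=I_{p,q}\}$ with Lie algebra $\mathfrak{su}(p,q)=\{Z\in\mathfrak{sl}_{p+q}(\mathbb{C})\mid ZI_{p,q}+I_{p,q}Z^*=0\}$; it carries the left-invariant semi-Riemannian metric $g$ determined by $g(Z,W)=-\operatorname{Re}\operatorname{trace}(ZW)$ on $\mathfrak{su}(p,q)$. For smooth complex-valued functions $\phi,\psi$, $\tau(\phi)=\operatorname{div}(\nabla\phi)$ is the Laplace-Beltrami operator (tension field) and $\kappa(\phi,\psi)=g(\nabla\phi,\nabla\psi)$ is the conformality operator,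 where $g$ is extended complex-bilinearly to the complexified tangent bundle. A set $\mathcal{E}$ of complex-valued functions is an eigenfamily if there exist $\lambda,\mu\in\mathbb{C}$ with $\tau(\phi)=\lambda\phi$ and $\kappa(\phi,\psi)=\mu\phi\psi$ for all $\phi,\psi\in\mathcal{E}$. *)

theory Defs
  imports "HOL-Analysis.Analysis" "HOL-Library.Function_Algebras"
begin

section \<open>Semi-Riemannian geometry of an embedded submanifold\<close>

text \<open>
  A semi-Riemannian manifold is given by an embedded submanifold \<open>M\<close> of a Euclidean space, its
  tangent spaces \<open>T x\<close> (linear subspaces of the ambient space) and its metric \<open>g x X Y\<close>
  (\<open>x \<in> M\<close> and \<open>X, Y \<in> T x\<close>). Functions and vector fields on \<open>M\<close> are functions on the ambient
  type of which only the values on \<open>M\<close> matter.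
\<close>

fun C_k_on :: "nat \<Rightarrow> 'a::real_normed_vector set \<Rightarrow> ('a \<Rightarrow> 'b::real_normed_vector) \<Rightarrow> bool" where
  "C_k_on 0 U f \<longleftrightarrow> continuous_on U f"
| "C_k_on (Suc k) U f \<longleftrightarrow>
     f differentiable_on U \<and> (\<forall>w. C_k_on k U (\<lambda>x. frechet_derivative f (at x) w))"

definition smooth_on_mfd :: "'a::euclidean_space set \<Rightarrow> ('a \<Rightarrow> 'b::real_normed_vector) \<Rightarrow> bool" where
  "smooth_on_mfd M f \<longleftrightarrow>
     (\<forall>x\<in>M. \<exists>U F. open U \<and> x \<in> U \<and> (\<forall>k. C_k_on k U F) \<and> (\<forall>y\<in>M \<inter> U. F y = f y))"

text \<open>
  The differential of \<open>f\<close> at \<open>x\<close> applied to \<open>X\<close>. The derivative within \<open>M\<close> is unique only on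
  vectors tangent to \<open>M\<close>, and it is only applied to those.
\<close>

definition mfd_deriv ::
  "'a::euclidean_space set \<Rightarrow> ('a \<Rightarrow> 'b::real_normed_vector) \<Rightarrow> 'a \<Rightarrow> 'a \<Rightarrow> 'b" where
  "mfd_deriv M f x X = frechet_derivative f (at x within M) X"

definition vector_fields ::
  "'a::euclidean_space set \<Rightarrow> ('a \<Rightarrow> 'a set) \<Rightarrow> ('a \<Rightarrow> 'a) set" where
  "vector_fields M T = {Y. smooth_on_mfd M Y \<and> (\<forall>x\<in>M. Y x \<in> T x)}"

definition lie_bracket ::
  "'a::euclidean_space set \<Rightarrow> ('a \<Rightarrow> 'a) \<Rightarrow> ('a \<Rightarrow> 'a) \<Rightarrow> 'a \<Rightarrow> 'a" where
  "lie_bracket M X Y x = mfd_deriv M Y x (X x) - mfd_deriv M X x (Y x)"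

text \<open>
  \<open>D Y x X\<close> is the covariant derivative of the vector field \<open>Y\<close> at \<open>x\<close> in direction \<open>X \<in> T x\<close>.
\<close>

definition affine_connection ::
  "'a::euclidean_space set \<Rightarrow> ('a \<Rightarrow> 'a set) \<Rightarrow> (('a \<Rightarrow> 'a) \<Rightarrow> 'a \<Rightarrow> 'a \<Rightarrow> 'a) \<Rightarrow> bool" where
  "affine_connection M T D \<longleftrightarrow>
     (\<forall>Y\<in>vector_fields M T. \<forall>x\<in>M. \<forall>X\<in>T x. \<forall>X'\<in>T x. \<forall>c d.
        D Y x (c *\<^sub>R X + d *\<^sub>R X') = c *\<^sub>R D Y x X + d *\<^sub>R D Y x X') \<and>
     (\<forall>X\<in>vector_fields M T. \<forall>Y\<in>vector_fields M T. (\<lambda>x. D Y x (X x)) \<in> vector_fields M T) \<and>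
     (\<forall>Y\<in>vector_fields M T. \<forall>Z\<in>vector_fields M T. \<forall>x\<in>M. \<forall>X\<in>T x.
        D (\<lambda>y. Y y + Z y) x X = D Y x X + D Z x X) \<and>
     (\<forall>f::'a \<Rightarrow> real. smooth_on_mfd M f \<longrightarrow>
       (\<forall>Y\<in>vector_fields M T. \<forall>x\<in>M. \<forall>X\<in>T x.
          D (\<lambda>y. f y *\<^sub>R Y y) x X = mfd_deriv M f x X *\<^sub>R Y x + f x *\<^sub>R D Y x X))"

definition levi_civita ::
  "'a::euclidean_space set \<Rightarrow> ('a \<Rightarrow> 'a set) \<Rightarrow> ('a \<Rightarrow> 'a \<Rightarrow> 'a \<Rightarrow> real) \<Rightarrow>
     (('a \<Rightarrow> 'a) \<Rightarrow> 'a \<Rightarrow> 'a \<Rightarrow> 'a) \<Rightarrow> bool" where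
  "levi_civita M T g D \<longleftrightarrow> affine_connection M T D \<and>
     (\<forall>Y\<in>vector_fields M T. \<forall>Z\<in>vector_fields M T. \<forall>x\<in>M. \<forall>X\<in>T x.
        mfd_deriv M (\<lambda>y. g y (Y y) (Z y)) x X = g x (D Y x X) (Z x) + g x (Y x) (D Z x X)) \<and>
     (\<forall>X\<in>vector_fields M T. \<forall>Y\<in>vector_fields M T. \<forall>x\<in>M.
        D Y x (X x) - D X x (Y x) = lie_bracket M X Y x)"

definition trace_on :: "'a::euclidean_space set \<Rightarrow> ('a \<Rightarrow> 'a) \<Rightarrow> real" where
  "trace_on V L = (let B = (SOME B. independent B \<and> span B = V)
                   in \<Sum>b\<in>B. representation B (L b) b)"

definition divergence ::
  "'a::euclidean_space set \<Rightarrow> ('a \<Rightarrow> 'a set) \<Rightarrow> ('a \<Rightarrow> 'a \<Rightarrow> 'a \<Rightarrow> real) \<Rightarrow> ('a \<Rightarrow> 'a) \<Rightarrow> 'a \<Rightarrow> real" where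
  "divergence M T g Y x = trace_on (T x) ((SOME D. levi_civita M T g D) Y x)"

definition gradient ::
  "'a::euclidean_space set \<Rightarrow> ('a \<Rightarrow> 'a set) \<Rightarrow> ('a \<Rightarrow> 'a \<Rightarrow> 'a \<Rightarrow> real) \<Rightarrow> ('a \<Rightarrow> real) \<Rightarrow> 'a \<Rightarrow> 'a" where
  "gradient M T g u x = (THE W. W \<in> T x \<and> (\<forall>X\<in>T x. g x W X = mfd_deriv M u x X))"

text \<open>
  An element \<open>X + \<i> Y\<close> of the complexified tangent space is represented by the pair \<open>(X, Y)\<close>.
  The gradient and the divergence are extended complex-linearly and the metric
  complex-bilinearly.
\<close>

definition cgradient ::
  "'a::euclidean_space set \<Rightarrow> ('a \<Rightarrow> 'a set) \<Rightarrow> ('a \<Rightarrow> 'a \<Rightarrow> 'a \<Rightarrow> real) \<Rightarrow>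
     ('a \<Rightarrow> complex) \<Rightarrow> 'a \<Rightarrow> 'a \<times> 'a" where
  "cgradient M T g \<phi> x =
     (gradient M T g (\<lambda>y. Re (\<phi> y)) x, gradient M T g (\<lambda>y. Im (\<phi> y)) x)"

definition cdivergence ::
  "'a::euclidean_space set \<Rightarrow> ('a \<Rightarrow> 'a set) \<Rightarrow> ('a \<Rightarrow> 'a \<Rightarrow> 'a \<Rightarrow> real) \<Rightarrow>
     ('a \<Rightarrow> 'a \<times> 'a) \<Rightarrow> 'a \<Rightarrow> complex" where
  "cdivergence M T g Y x =
     Complex (divergence M T g (\<lambda>y. fst (Y y)) x) (divergence M T g (\<lambda>y. snd (Y y)) x)"

definition cmetric :: "('a \<Rightarrow> 'a \<Rightarrow> 'a \<Rightarrow> real) \<Rightarrow> 'a \<Rightarrow> 'a \<times> 'a \<Rightarrow> 'a \<times> 'a \<Rightarrow> complex" where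
  "cmetric g x V W =
     Complex (g x (fst V) (fst W) - g x (snd V) (snd W))
             (g x (fst V) (snd W) + g x (snd V) (fst W))"

definition tension_field ::
  "'a::euclidean_space set \<Rightarrow> ('a \<Rightarrow> 'a set) \<Rightarrow> ('a \<Rightarrow> 'a \<Rightarrow> 'a \<Rightarrow> real) \<Rightarrow>
     ('a \<Rightarrow> complex) \<Rightarrow> 'a \<Rightarrow> complex" where
  "tension_field M T g \<phi> = cdivergence M T g (cgradient M T g \<phi>)"

definition conformality ::
  "'a::euclidean_space set \<Rightarrow> ('a \<Rightarrow> 'a set) \<Rightarrow> ('a \<Rightarrow> 'a \<Rightarrow> 'a \<Rightarrow> real) \<Rightarrow>
     ('a \<Rightarrow> complex) \<Rightarrow> ('a \<Rightarrow> complex) \<Rightarrow> 'a \<Rightarrow> complex" where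
  "conformality M T g \<phi> \<psi> x = cmetric g x (cgradient M T g \<phi> x) (cgradient M T g \<psi> x)"

definition eigenfamily ::
  "'a::euclidean_space set \<Rightarrow> ('a \<Rightarrow> 'a set) \<Rightarrow> ('a \<Rightarrow> 'a \<Rightarrow> 'a \<Rightarrow> real) \<Rightarrow>
     ('a \<Rightarrow> complex) set \<Rightarrow> bool" where
  "eigenfamily M T g E \<longleftrightarrow>
     (\<forall>\<phi>\<in>E. smooth_on_mfd M \<phi>) \<and>
     (\<exists>l m. (\<forall>\<phi>\<in>E. \<forall>x\<in>M. tension_field M T g \<phi> x = l * \<phi> x) \<and>
            (\<forall>\<phi>\<in>E. \<forall>\<psi>\<in>E. \<forall>x\<in>M. conformality M T g \<phi> \<psi> x = m * \<phi> x * \<psi> x))"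

section \<open>The group SU(p,q)\<close>

text \<open>
  The integers \<open>p, q \<ge> 1\<close> are \<open>CARD('p)\<close> and \<open>CARD('q)\<close>; rows and columns are indexed by the
  disjoint sum \<open>'p + 'q\<close>.
\<close>

type_synonym ('p, 'q) cmat = "complex^('p + 'q)^('p + 'q)"

definition I_pq :: "('p::finite, 'q::finite) cmat" where
  "I_pq = (\<chi> i j. if i = j then (case i of Inl _ \<Rightarrow> -1 | Inr _ \<Rightarrow> 1) else 0)"

definition adjoint_matrix :: "complex^'n^'m \<Rightarrow> complex^'m^'n" where
  "adjoint_matrix z = map_matrix cnj (transpose z)"

definition SU :: "('p::finite, 'q::finite) cmat set" where
  "SU = {z. det z = 1 \<and> z ** I_pq ** adjoint_matrix z = I_pq}"

definition su_algebra :: "('p::finite, 'q::finite) cmat set" where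
  "su_algebra = {Z. trace Z = 0 \<and> Z ** I_pq + I_pq ** adjoint_matrix Z = 0}"

definition SU_tangent :: "('p::finite, 'q::finite) cmat \<Rightarrow> ('p, 'q) cmat set" where
  "SU_tangent z = (\<lambda>Z. z ** Z) ` su_algebra"

definition SU_metric ::
  "('p::finite, 'q::finite) cmat \<Rightarrow> ('p, 'q) cmat \<Rightarrow> ('p, 'q) cmat \<Rightarrow> real" where
  "SU_metric z X Y = - Re (trace ((matrix_inv z ** X) ** (matrix_inv z ** Y)))"

section \<open>The family of functions\<close>

definition outer :: "complex^'m \<Rightarrow> complex^'n \<Rightarrow> complex^'n^'m" where
  "outer v a = (\<chi> j \<alpha>. v $ j * a $ \<alpha>)"

text \<open>
  Complex-valued functions on \<open>SU(p,q)\<close> are identified with the functions that vanish outside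
  \<open>SU(p,q)\<close>, so that two of them are equal iff they agree on the group; the vector space
  structure is the pointwise one.
\<close>

definition phi ::
  "complex^('p::finite + 'q::finite) \<Rightarrow> complex^('p + 'q) \<Rightarrow> ('p, 'q) cmat \<Rightarrow> complex" where
  "phi v a z = (if z \<in> SU then trace (outer v a ** transpose z) else 0)"

definition eigen_space ::
  "complex^('p::finite + 'q::finite) \<Rightarrow> (('p, 'q) cmat \<Rightarrow> complex) set" where
  "eigen_space v = range (phi v)"

definition fun_scale :: "complex \<Rightarrow> ('a \<Rightarrow> complex) \<Rightarrow> 'a \<Rightarrow> complex" where
  "fun_scale c f = (\<lambda>x. c * f x)"

lemma vector_space_fun_scale: "vector_space fun_scale"
  by unfold_locales (auto simp: fun_scale_def fun_eq_iff algebra_simps)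

end

theory Submission
  imports Defs
begin

text \<open>
  On \<open>SU(p,q)\<close> the inverse is \<open>\<iota>(z) = I z\<^sup>* I\<close>, a real-linear anti-involution, and \<open>su(p,q)\<close> is its
  \<open>-1\<close> eigenspace in \<open>sl\<^sub>n\<close>, \<open>n = p + q\<close>. If \<open>\<xi>\<close> is a null vector of \<open>I\<close>, then
  \<open>Z = i \<xi> \<xi>\<^sup>* I\<close> satisfies \<open>Z\<^sup>2 = 0\<close>, so the whole line \<open>x (1 + t Z)\<close> stays in the group; such \<open>Z\<close>
  span \<open>su(p,q)\<close>. Hence derivatives within the group are determined on tangent vectors by
  derivatives along straight lines, and no exponential map is needed.

  With \<open>N = a\<^sup>t v\<close> the function \<open>\<phi>\<^sub>a(x) = tr(N x)\<close> has complexified gradient \<open>x U(x)\<close>, where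
  \<open>U(x) = \<phi>\<^sub>a(x)/n - N x\<close>, and the gradient of \<open>Re \<phi>\<^sub>a\<close> is obtained by projecting \<open>U(x)\<close> to
  \<open>su(p,q)\<close>; moreover \<open>Im \<phi>\<^sub>a = Re \<phi>\<close> for the parameter \<open>-i a\<close>. The Levi-Civita connection is
  \<open>\<nabla>\<^sub>X Y = dY(X) - (X x\<^sup>-\<^sup>1 Y + Y x\<^sup>-\<^sup>1 X)/2\<close>, so the tension field is the trace of
  \<open>Z \<mapsto> tr(N x Z)/n - N x Z\<close>, namely \<open>(1/n - n) \<phi>\<^sub>a(x)\<close>, and since \<open>N\<close> has rank one
  \<open>tr(N\<^sub>a x U\<^sub>b(x)) = \<phi>\<^sub>a \<phi>\<^sub>b/n - \<phi>\<^sub>a \<phi>\<^sub>b\<close>.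
\<close>

section \<open>Smooth functions on a subset of Euclidean space\<close>

lemma C_k_on_cong:
  assumes "open U" "\<And>x. x \<in> U \<Longrightarrow> f x = g x" "C_k_on k U f"
  shows "C_k_on k U g"
  using assms(2,3)
proof (induction k arbitrary: f g)
  case 0
  then show ?case by (auto cong: continuous_on_cong)
next
  case (Suc k)
  have d: "f differentiable (at x)" if "x \<in> U" for x
    using Suc.prems(2) that assms(1) by (auto simp: differentiable_on_eq_differentiable_at)
  have eq: "frechet_derivative f (at x) = frechet_derivative g (at x)" if "x \<in> U" for x
    using frechet_derivative_transform_within_open[OF d[OF that] assms(1) that] Suc.prems(1) by blast
  have "g differentiable_on U"
    unfolding differentiable_on_eq_differentiable_at[OF assms(1)]
  proof
    fix x assume "x \<in> U"
    then have "(g has_derivative frechet_derivative f (at x)) (at x)"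
      using d[of x] assms(1) Suc.prems(1)
      by (meson frechet_derivative_works has_derivative_transform_within_open)
    then show "g differentiable (at x)" by (rule differentiableI)
  qed
  moreover have "C_k_on k U (\<lambda>x. frechet_derivative g (at x) w)" for w
    using Suc.IH[of "\<lambda>x. frechet_derivative f (at x) w"] Suc.prems(2) eq by auto
  ultimately show ?case by simp
qed

text \<open>The derivative at a point is unique, so an explicit \<open>f'\<close> may replace the
  chosen \<open>frechet_derivative\<close>. The closure properties below all go through this
  rule.\<close>

lemma C_k_on_SucI:
  assumes "open U" "\<And>x. x \<in> U \<Longrightarrow> (f has_derivative f' x) (at x)"
    and "\<And>w. C_k_on k U (\<lambda>x. f' x w)"
  shows "C_k_on (Suc k) U f"
proof -
  have "f differentiable_on U"
    using assms(1,2) differentiableI by (auto simp: differentiable_on_eq_differentiable_at)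
  moreover have "C_k_on k U (\<lambda>x. frechet_derivative f (at x) w)" for w
    by (rule C_k_on_cong[OF assms(1) _ assms(3)[of w]])
       (use frechet_derivative_at[OF assms(2)] in \<open>simp\<close>)
  ultimately show ?thesis by simp
qed

lemma C_k_on_Suc_has_derivative:
  assumes "open U" "C_k_on (Suc k) U f" "x \<in> U"
  shows "(f has_derivative frechet_derivative f (at x)) (at x)"
  using assms by (simp add: differentiable_on_eq_differentiable_at flip: frechet_derivative_works)

lemma C_k_on_SucD: "C_k_on (Suc k) U f \<Longrightarrow> C_k_on k U f"
proof (induction k arbitrary: f)
  case 0
  then show ?case by (simp add: differentiable_imp_continuous_on)
next
  case (Suc k)
  then show ?case by (metis C_k_on.simps(2))
qed

lemma C_k_on_subset:
  assumes "open U" "open V" "V \<subseteq> U" "C_k_on k U f"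
  shows "C_k_on k V f"
  using assms(4)
proof (induction k arbitrary: f)
  case 0
  then show ?case using assms continuous_on_subset by auto
next
  case (Suc k)
  then show ?case using assms differentiable_on_subset by auto
qed

lemma C_k_on_const: "open U \<Longrightarrow> C_k_on k U (\<lambda>x. c)"
  by (induction k arbitrary: c) (auto simp: continuous_on_const)

lemma C_k_on_bounded_linear:
  assumes "bounded_linear f" "open U"
  shows "C_k_on k U f"
proof (cases k)
  case 0
  then show ?thesis using assms by (simp add: linear_continuous_on)
next
  case (Suc n)
  show ?thesis unfolding Suc
    by (rule C_k_on_SucI[OF assms(2) bounded_linear_imp_has_derivative[OF assms(1)]])
       (rule C_k_on_const[OF assms(2)])
qed

lemma C_k_on_compose_bounded_linear:
  assumes "bounded_linear L" "open U" "C_k_on k U f"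
  shows "C_k_on k U (\<lambda>x. L (f x))"
  using assms(3)
proof (induction k arbitrary: f)
  case 0
  then show ?case
    using assms(1) bounded_linear.continuous_on[OF assms(1)] by auto
next
  case (Suc k)
  show ?case
  proof (rule C_k_on_SucI[OF assms(2)])
    show "((\<lambda>x. L (f x)) has_derivative (\<lambda>h. L (frechet_derivative f (at x) h))) (at x)" if "x \<in> U" for x
      by (rule bounded_linear.has_derivative[OF assms(1) C_k_on_Suc_has_derivative[OF assms(2) Suc.prems that]])
    show "C_k_on k U (\<lambda>x. L (frechet_derivative f (at x) w))" for w
      using Suc by simp
  qed
qed

lemma C_k_on_add:
  assumes "open U" "C_k_on k U f" "C_k_on k U g"
  shows "C_k_on k U (\<lambda>x. f x + g x)"
  using assms(2,3)
proof (induction k arbitrary: f g)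
  case 0
  then show ?case by (auto intro: continuous_on_add)
next
  case (Suc k)
  show ?case
  proof (rule C_k_on_SucI[OF assms(1)])
    show "((\<lambda>x. f x + g x) has_derivative
        (\<lambda>h. frechet_derivative f (at x) h + frechet_derivative g (at x) h)) (at x)" if "x \<in> U" for x
      by (intro has_derivative_add C_k_on_Suc_has_derivative[OF assms(1) _ that, of k] Suc.prems)
    show "C_k_on k U (\<lambda>x. frechet_derivative f (at x) w + frechet_derivative g (at x) w)" for w
      using Suc by simp
  qed
qed

lemma C_k_on_bounded_bilinear:
  assumes B: "bounded_bilinear B" and U: "open U" and "C_k_on k U f" "C_k_on k U g"
  shows "C_k_on k U (\<lambda>x. B (f x) (g x))"
  using assms(3,4)
proof (induction k arbitrary: f g)
  case 0
  then show ?case using bounded_bilinear.continuous_on[OF B] by auto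
next
  case (Suc k)
  show ?case
  proof (rule C_k_on_SucI[OF U])
    show "((\<lambda>x. B (f x) (g x)) has_derivative
        (\<lambda>h. B (f x) (frechet_derivative g (at x) h) + B (frechet_derivative f (at x) h) (g x))) (at x)"
      if "x \<in> U" for x
      by (intro bounded_bilinear.FDERIV[OF B] C_k_on_Suc_has_derivative[OF U _ that, of k] Suc.prems)
    \<comment> \<open>In each term of the product rule one factor is undifferentiated; its order of
      smoothness is lowered so that the induction hypothesis fits.\<close>
    show "C_k_on k U (\<lambda>x. B (f x) (frechet_derivative g (at x) w) + B (frechet_derivative f (at x) w) (g x))" for w
    proof (rule C_k_on_add[OF U])
      show "C_k_on k U (\<lambda>x. B (f x) (frechet_derivative g (at x) w))"
        by (rule Suc.IH[OF C_k_on_SucD[OF Suc.prems(1)]]) (use Suc.prems(2) in simp)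
      show "C_k_on k U (\<lambda>x. B (frechet_derivative f (at x) w) (g x))"
        by (rule Suc.IH[OF _ C_k_on_SucD[OF Suc.prems(2)]]) (use Suc.prems(1) in simp)
    qed
  qed
qed

lemma C_k_on_sum:
  assumes "open U" "finite A" "\<And>i. i \<in> A \<Longrightarrow> C_k_on k U (f i)"
  shows "C_k_on k U (\<lambda>x. \<Sum>i\<in>A. f i x)"
  using assms(2,3)
  by (induction A rule: finite_induct) (auto intro: C_k_on_const C_k_on_add assms(1))

section \<open>Smoothness on a subset through local smooth extensions\<close>

lemma smooth_on_mfdE:
  assumes "smooth_on_mfd M f" "x \<in> M"
  obtains U F where "open U" "x \<in> U" "\<And>k. C_k_on k U F" "\<And>y. y \<in> M \<Longrightarrow> y \<in> U \<Longrightarrow> F y = f y"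
  using assms unfolding smooth_on_mfd_def by (metis IntI)

lemma smooth_on_mfd_cong:
  assumes "\<And>x. x \<in> M \<Longrightarrow> f x = g x" "smooth_on_mfd M f"
  shows "smooth_on_mfd M g"
  unfolding smooth_on_mfd_def
proof
  fix x assume "x \<in> M"
  obtain U F where "open U" "x \<in> U" "\<And>k. C_k_on k U F" "\<And>y. y \<in> M \<Longrightarrow> y \<in> U \<Longrightarrow> F y = f y"
    using smooth_on_mfdE[OF assms(2) \<open>x \<in> M\<close>] by metis
  then show "\<exists>U F. open U \<and> x \<in> U \<and> (\<forall>k. C_k_on k U F) \<and> (\<forall>y\<in>M \<inter> U. F y = g y)"
    using assms(1) by (intro exI[of _ U] exI[of _ F]) auto
qed

lemma smooth_on_mfd_bounded_linear:
  assumes "bounded_linear f"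
  shows "smooth_on_mfd M f"
  unfolding smooth_on_mfd_def using C_k_on_bounded_linear[OF assms open_UNIV] by blast

lemma smooth_on_mfd_compose_bounded_linear:
  assumes "bounded_linear L" "smooth_on_mfd M f"
  shows "smooth_on_mfd M (\<lambda>x. L (f x))"
  unfolding smooth_on_mfd_def
proof
  fix x assume "x \<in> M"
  obtain U F where *: "open U" "x \<in> U" "\<And>k. C_k_on k U F" "\<And>y. y \<in> M \<Longrightarrow> y \<in> U \<Longrightarrow> F y = f y"
    using smooth_on_mfdE[OF assms(2) \<open>x \<in> M\<close>] by metis
  then show "\<exists>U F. open U \<and> x \<in> U \<and> (\<forall>k. C_k_on k U F) \<and> (\<forall>y\<in>M \<inter> U. F y = L (f y))"
    using C_k_on_compose_bounded_linear[OF assms(1) *(1)]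
    by (intro exI[of _ U] exI[of _ "\<lambda>x. L (F x)"]) auto
qed

lemma smooth_on_mfd_common_nbhd:
  assumes "smooth_on_mfd M f" "smooth_on_mfd M g" "x \<in> M"
  obtains U F G where "open U" "x \<in> U" "\<And>k. C_k_on k U F" "\<And>k. C_k_on k U G"
    "\<And>y. y \<in> M \<Longrightarrow> y \<in> U \<Longrightarrow> F y = f y" "\<And>y. y \<in> M \<Longrightarrow> y \<in> U \<Longrightarrow> G y = g y"
proof -
  obtain U F where U: "open U" "x \<in> U" "\<And>k. C_k_on k U F" "\<And>y. y \<in> M \<Longrightarrow> y \<in> U \<Longrightarrow> F y = f y"
    using smooth_on_mfdE[OF assms(1,3)] by metis
  obtain V G where V: "open V" "x \<in> V" "\<And>k. C_k_on k V G" "\<And>y. y \<in> M \<Longrightarrow> y \<in> V \<Longrightarrow> G y = g y"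
    using smooth_on_mfdE[OF assms(2,3)] by metis
  show thesis
    by (rule that[of "U \<inter> V" F G])
       (use U V in \<open>auto intro: C_k_on_subset[OF U(1)] C_k_on_subset[OF V(1)]\<close>)
qed

lemma smooth_on_mfd_bounded_bilinear:
  assumes "bounded_bilinear B" "smooth_on_mfd M f" "smooth_on_mfd M g"
  shows "smooth_on_mfd M (\<lambda>x. B (f x) (g x))"
  unfolding smooth_on_mfd_def
proof
  fix x assume "x \<in> M"
  obtain U F G where *: "open U" "x \<in> U" "\<And>k. C_k_on k U F" "\<And>k. C_k_on k U G"
    "\<And>y. y \<in> M \<Longrightarrow> y \<in> U \<Longrightarrow> F y = f y" "\<And>y. y \<in> M \<Longrightarrow> y \<in> U \<Longrightarrow> G y = g y"
    using smooth_on_mfd_common_nbhd[OF assms(2,3) \<open>x \<in> M\<close>] by metis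
  then show "\<exists>U F. open U \<and> x \<in> U \<and> (\<forall>k. C_k_on k U F) \<and> (\<forall>y\<in>M \<inter> U. F y = B (f y) (g y))"
    using C_k_on_bounded_bilinear[OF assms(1) *(1)]
    by (intro exI[of _ U] exI[of _ "\<lambda>x. B (F x) (G x)"]) auto
qed

lemma smooth_on_mfd_add:
  assumes "smooth_on_mfd M f" "smooth_on_mfd M g"
  shows "smooth_on_mfd M (\<lambda>x. f x + g x)"
  unfolding smooth_on_mfd_def
proof
  fix x assume "x \<in> M"
  obtain U F G where *: "open U" "x \<in> U" "\<And>k. C_k_on k U F" "\<And>k. C_k_on k U G"
    "\<And>y. y \<in> M \<Longrightarrow> y \<in> U \<Longrightarrow> F y = f y" "\<And>y. y \<in> M \<Longrightarrow> y \<in> U \<Longrightarrow> G y = g y"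
    using smooth_on_mfd_common_nbhd[OF assms(1,2) \<open>x \<in> M\<close>] by metis
  then show "\<exists>U F. open U \<and> x \<in> U \<and> (\<forall>k. C_k_on k U F) \<and> (\<forall>y\<in>M \<inter> U. F y = f y + g y)"
    by (intro exI[of _ U] exI[of _ "\<lambda>x. F x + G x"]) (auto intro: C_k_on_add)
qed

lemma has_derivative_within_cong_nbhd:
  assumes "(F has_derivative F') (at x)" "open U" "x \<in> U" "x \<in> M"
    and "\<And>y. y \<in> M \<Longrightarrow> y \<in> U \<Longrightarrow> F y = f y"
  shows "(f has_derivative F') (at x within M)"
proof -
  obtain e where e: "e > 0" "ball x e \<subseteq> U"
    using assms(2,3) openE by blast
  show ?thesis
    by (rule has_derivative_transform_within[OF has_derivative_at_withinI[OF assms(1)] e(1) assms(4)])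
       (use e assms(5) in \<open>auto simp: subset_iff dist_commute\<close>)
qed

text \<open>The derivative of a local extension shows that a derivative within \<open>M\<close>
  exists, so the one chosen by \<open>mfd_deriv\<close> is a genuine derivative. Uniqueness is not
  claimed here.\<close>

lemma smooth_on_mfd_has_derivative:
  assumes "smooth_on_mfd M f" "x \<in> M"
  shows "(f has_derivative mfd_deriv M f x) (at x within M)"
proof -
  obtain U F where U: "open U" "x \<in> U" "\<And>k. C_k_on k U F" "\<And>y. y \<in> M \<Longrightarrow> y \<in> U \<Longrightarrow> F y = f y"
    using smooth_on_mfdE[OF assms] by metis
  have "(f has_derivative frechet_derivative F (at x)) (at x within M)"
    by (rule has_derivative_within_cong_nbhd[OF C_k_on_Suc_has_derivative[OF U(1) U(3) U(2)] U(1,2) assms(2) U(4)])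
  then show ?thesis
    unfolding mfd_deriv_def[abs_def] using frechet_derivative_works differentiableI by blast
qed

text \<open>Expanding \<open>X\<close> in coordinates turns the derivative into a sum of smooth
  coefficients times derivatives of an extension in fixed basis directions, which
  \<open>C_k_on\<close> controls. The hypothesis \<open>uniq\<close> makes the extension compute
  \<open>mfd_deriv\<close> along \<open>X\<close>.\<close>

lemma smooth_on_mfd_directional_derivative:
  fixes M :: "'a::euclidean_space set" and Y :: "'a \<Rightarrow> 'b::real_normed_vector"
  assumes uniq: "\<And>x f'. x \<in> M \<Longrightarrow> (Y has_derivative f') (at x within M) \<Longrightarrow> mfd_deriv M Y x (X x) = f' (X x)"
    and Y: "smooth_on_mfd M Y" and X: "smooth_on_mfd M X"
  shows "smooth_on_mfd M (\<lambda>x. mfd_deriv M Y x (X x))"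
  unfolding smooth_on_mfd_def
proof
  fix x assume "x \<in> M"
  obtain U F G where *: "open U" "x \<in> U" "\<And>k. C_k_on k U F" "\<And>k. C_k_on k U G"
    "\<And>y. y \<in> M \<Longrightarrow> y \<in> U \<Longrightarrow> F y = Y y" "\<And>y. y \<in> M \<Longrightarrow> y \<in> U \<Longrightarrow> G y = X y"
    using smooth_on_mfd_common_nbhd[OF Y X \<open>x \<in> M\<close>] by metis
  let ?H = "\<lambda>y. \<Sum>b\<in>Basis. (G y \<bullet> b) *\<^sub>R frechet_derivative F (at y) b"
  have der: "(F has_derivative frechet_derivative F (at y)) (at y)" if "y \<in> U" for y
    using C_k_on_Suc_has_derivative[OF *(1) *(3) that] .
  have "C_k_on k U ?H" for k
  proof (rule C_k_on_sum[OF *(1) finite_Basis])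
    fix b :: 'a
    have "C_k_on k U (\<lambda>y. frechet_derivative F (at y) b)"
      using *(3)[of "Suc k"] by simp
    then show "C_k_on k U (\<lambda>y. (G y \<bullet> b) *\<^sub>R frechet_derivative F (at y) b)"
      by (intro C_k_on_bounded_bilinear[OF bounded_bilinear_scaleR *(1)]
          C_k_on_compose_bounded_linear[OF bounded_linear_inner_left *(1)] *(4))
  qed
  moreover have "?H y = mfd_deriv M Y y (X y)" if "y \<in> M" "y \<in> U" for y
  proof -
    interpret linear "frechet_derivative F (at y)"
      using der[OF that(2)] has_derivative_linear by blast
    have "mfd_deriv M Y y (X y) = frechet_derivative F (at y) (G y)"
      using uniq[OF that(1) has_derivative_within_cong_nbhd[OF der[OF that(2)] *(1) that(2,1) *(5)]] *(6) that
      by simp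
    also have "\<dots> = frechet_derivative F (at y) (\<Sum>b\<in>Basis. (G y \<bullet> b) *\<^sub>R b)"
      by (simp add: euclidean_representation)
    also have "\<dots> = ?H y" by (simp only: sum scale)
    finally show ?thesis by simp
  qed
  ultimately show "\<exists>U F. open U \<and> x \<in> U \<and> (\<forall>k. C_k_on k U F) \<and> (\<forall>y\<in>M \<inter> U. F y = mfd_deriv M Y y (X y))"
    using *(1,2) by (intro exI[of _ U] exI[of _ ?H]) auto
qed

section \<open>Traces of linear maps into a subspace\<close>

text \<open>
  The change of frame \<open>A\<close> allows the trace over \<open>x su(p,q)\<close> to be computed with matrix units
  after left translation by \<open>x\<close>.
\<close>

lemma trace_on_eq_sum_Basis:
  fixes L :: "'a::euclidean_space \<Rightarrow> 'a"
  assumes V: "subspace V" and L: "linear L" "\<And>y. L y \<in> V"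
    and A: "linear A" "linear A'" "\<And>y. A (A' y) = y"
  shows "trace_on V L = (\<Sum>e\<in>Basis. A' (L (A e)) \<bullet> e)"
proof -
  define B where "B = (SOME B. independent B \<and> span B = V)"
  have "\<exists>B. independent B \<and> span B = V"
    using basis_exists[of V] V by (metis span_eq_iff span_minimal subset_antisym span_mono)
  then have B: "independent B" "span B = V"
    unfolding B_def by (metis (mono_tags, lifting) someI_ex)+
  have "finite B" using B(1) by (rule finiteI_independent)
  \<comment> \<open>The vectors \<open>A e\<close> form a frame in which \<open>b\<close> has the
    coefficients \<open>A' b \<bullet> e\<close>. Every \<open>L (A e)\<close> has coordinates in
    \<open>B\<close> because the range of \<open>L\<close> lies in \<open>V\<close>.\<close>
  have *: "representation B (L b) c = (\<Sum>e\<in>Basis. (A' b \<bullet> e) * representation B (L (A e)) c)" for b c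
  proof -
    have "L b = L (A (\<Sum>e\<in>Basis. (A' b \<bullet> e) *\<^sub>R e))"
      by (simp add: euclidean_representation A)
    also have "\<dots> = (\<Sum>e\<in>Basis. (A' b \<bullet> e) *\<^sub>R L (A e))"
      by (simp add: linear_sum[OF L(1)] linear_sum[OF A(1)] linear_scale[OF L(1)] linear_scale[OF A(1)])
    finally have 1: "representation B (L b) = representation B (\<Sum>e\<in>Basis. (A' b \<bullet> e) *\<^sub>R L (A e))"
      by simp
    also have "\<dots> = (\<lambda>c. \<Sum>e\<in>Basis. representation B ((A' b \<bullet> e) *\<^sub>R L (A e)) c)"
      by (rule representation_sum[OF B(1)]) (use L(2) B(2) V in \<open>auto intro: subspace_scale\<close>)
    finally show ?thesis
      using L(2) B by (auto simp: representation_scale)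
  qed
  have "trace_on V L = (\<Sum>b\<in>B. representation B (L b) b)"
    by (simp add: trace_on_def B_def Let_def)
  also have "\<dots> = (\<Sum>e\<in>Basis. \<Sum>b\<in>B. (A' b \<bullet> e) * representation B (L (A e)) b)"
    by (subst sum.swap) (rule sum.cong[OF refl *])
  also have "\<dots> = (\<Sum>e\<in>Basis. A' (\<Sum>b\<in>B. representation B (L (A e)) b *\<^sub>R b) \<bullet> e)"
    by (simp add: linear_sum[OF A(2)] linear_scale[OF A(2)] inner_sum_left mult.commute)
  also have "\<dots> = (\<Sum>e\<in>Basis. A' (L (A e)) \<bullet> e)"
    using sum_representation_eq[OF B(1) _ \<open>finite B\<close> order.refl] L(2) B(2) by simp
  finally show ?thesis .
qed

text \<open>The basis chosen in \<open>trace_on\<close> depends only on \<open>V\<close> and lies in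
  \<open>V\<close>. A connection known only on tangent vectors can therefore be replaced by a
  formula on the whole matrix space.\<close>

lemma trace_on_cong:
  assumes "\<And>X. X \<in> V \<Longrightarrow> L X = L' X" "subspace V"
  shows "trace_on V L = trace_on V L'"
proof -
  define B where "B = (SOME B. independent B \<and> span B = V)"
  have "\<exists>B. independent B \<and> span B = V"
    using basis_exists[of V] assms(2) by (metis span_minimal subset_antisym)
  then have "span B = V"
    unfolding B_def by (metis (mono_tags, lifting) someI_ex)
  then have "L b = L' b" if "b \<in> B" for b using assms(1) that span_base by blast
  then show ?thesis unfolding trace_on_def Let_def B_def[symmetric] by simp
qed

section \<open>The group and its Lie algebra\<close>

lemma matrix_add_rdistrib: "(A + B) ** C = A ** C + B ** C"
  by (simp add: vec_eq_iff matrix_matrix_mult_def sum.distrib distrib_right)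

lemma bounded_bilinear_matrix_mult:
  "bounded_bilinear ((**) :: complex^'n^'m \<Rightarrow> complex^'k^'n \<Rightarrow> complex^'k^'m)"
  unfolding bilinear_conv_bounded_bilinear[symmetric] bilinear_def linear_iff
  by (simp add: matrix_add_ldistrib matrix_add_rdistrib matrix_scalar_ac scalar_matrix_assoc)

interpretation matrix_mult: bounded_bilinear "(**) :: complex^'n^'m \<Rightarrow> complex^'k^'n \<Rightarrow> complex^'k^'m"
  by (rule bounded_bilinear_matrix_mult)

lemma linear_trace: "linear (trace :: complex^'n^'n \<Rightarrow> complex)"
  unfolding linear_iff by (simp add: trace_def sum.distrib scaleR_sum_right)

lemmas bounded_linear_trace = linear_trace[unfolded linear_conv_bounded_linear]

lemmas trace_linear_simps =
  linear_0[OF linear_trace] linear_add[OF linear_trace] linear_diff[OF linear_trace]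
  linear_neg[OF linear_trace] linear_scale[OF linear_trace]

lemma mat_add: "mat (a + b) = mat a + (mat b :: 'a::semiring_1^'n^'n)"
  by (simp add: mat_def vec_eq_iff)

lemma mat_scaleR: "mat (r *\<^sub>R c) = r *\<^sub>R (mat c :: complex^'n^'n)"
  by (simp add: mat_def vec_eq_iff)

lemma mat_uminus: "mat (- c) = - (mat c :: 'a::ring_1^'n^'n)"
  by (simp add: mat_def vec_eq_iff)

lemma mat_mult_nth: "(mat c ** A) $ i $ j = c * A $ i $ j" for A :: "'a::semiring_1^'n^'m"
  by (simp add: matrix_matrix_mult_def mat_def if_distrib if_distribR cong: if_cong)

lemma mult_mat_nth: "(A ** mat c) $ i $ j = A $ i $ j * c" for A :: "'a::semiring_1^'n^'m"
  by (simp add: matrix_matrix_mult_def mat_def if_distrib if_distribR cong: if_cong)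

lemma mat_mult_commute: "mat c ** A = A ** mat c" for A :: "'a::comm_semiring_1^'n^'m"
  by (simp add: vec_eq_iff mat_mult_nth mult_mat_nth mult.commute)

lemma trace_mat: "trace (mat c :: complex^'n^'n) = of_nat CARD('n) * c"
  by (simp add: trace_def mat_def)

lemma trace_mat_mult: "trace (mat c ** A) = c * trace A" for A :: "complex^'n^'n"
  by (simp add: trace_def mat_mult_nth sum_distrib_left)

lemma trace_mult_commute: "trace (A ** B) = trace (B ** A)"
  for A :: "'a::comm_semiring_1^'n^'m" and B :: "'a^'m^'n"
  by (simp add: trace_def matrix_matrix_mult_def) (subst sum.swap, simp add: mult.commute)

definition eps :: "'p + 'q \<Rightarrow> complex" where
  "eps i = (case i of Inl _ \<Rightarrow> - 1 | Inr _ \<Rightarrow> 1)"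

lemma eps_simps [simp]: "eps (Inl a) = -1" "eps (Inr b) = 1" "eps i * eps i = 1"
  "eps i * (eps i * c) = c" "cnj (eps i) = eps i"
  by (auto simp: eps_def split: sum.splits)

lemma I_pq_mult_nth: "(I_pq ** A) $ i $ j = eps i * A $ i $ j"
  by (simp add: I_pq_def eps_def matrix_matrix_mult_def if_distrib if_distribR cong: if_cong)

lemma mult_I_pq_nth: "(A ** I_pq) $ i $ j = A $ i $ j * eps j"
  by (simp add: I_pq_def eps_def matrix_matrix_mult_def if_distrib if_distribR cong: if_cong)

lemma I_pq_mult_I_pq [simp]: "I_pq ** I_pq = mat 1"
  by (simp add: vec_eq_iff I_pq_mult_nth) (simp add: I_pq_def mat_def eps_def split: sum.splits)

lemma eps_nonzero [simp]: "eps i \<noteq> 0"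
  by (cases i) simp_all

text \<open>The adjoint for the indefinite Hermitian form of \<open>I_pq\<close>. Using it in place
  of \<open>matrix_inv\<close> makes inversion on the group real-linear, hence smooth and its own
  derivative.\<close>

definition iadj :: "('p::finite, 'q::finite) cmat \<Rightarrow> ('p, 'q) cmat" where
  "iadj z = I_pq ** adjoint_matrix z ** I_pq"

lemma iadj_nth: "iadj z $ i $ j = eps i * cnj (z $ j $ i) * eps j"
  by (simp add: iadj_def mult_I_pq_nth I_pq_mult_nth adjoint_matrix_def transpose_def)

lemma iadj_iadj [simp]: "iadj (iadj z) = z"
  by (auto simp: vec_eq_iff iadj_nth eps_def split: sum.splits)

lemma iadj_mult: "iadj (A ** B) = iadj B ** iadj A"
  by (simp add: vec_eq_iff iadj_nth matrix_matrix_mult_def sum_distrib_left sum_distrib_right mult_ac)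

lemma iadj_mat [simp]: "iadj (mat c) = mat (cnj c)"
  by (auto simp: vec_eq_iff iadj_nth mat_def)

lemma linear_iadj: "linear iadj"
  unfolding linear_iff by (simp add: vec_eq_iff iadj_nth algebra_simps)

lemmas bounded_linear_iadj = linear_iadj[unfolded linear_conv_bounded_linear]

lemmas iadj_linear_simps =
  linear_0[OF linear_iadj] linear_add[OF linear_iadj] linear_diff[OF linear_iadj]
  linear_neg[OF linear_iadj] linear_scale[OF linear_iadj]

lemma trace_iadj: "trace (iadj z) = cnj (trace z)"
  by (simp add: trace_def iadj_nth mult_ac)

section \<open>The group, its Lie algebra and its tangent spaces in terms of
  \<open>iadj\<close>\<close>

lemma SU_iff: "z \<in> SU \<longleftrightarrow> det z = 1 \<and> z ** iadj z = mat 1"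
proof -
  have "z ** iadj z = z ** I_pq ** adjoint_matrix z ** I_pq"
    by (simp add: iadj_def matrix_mul_assoc)
  then have "z ** iadj z = mat 1 \<longleftrightarrow> z ** I_pq ** adjoint_matrix z = I_pq"
    by (metis I_pq_mult_I_pq matrix_mul_assoc matrix_mul_rid)
  then show ?thesis by (simp add: SU_def)
qed

lemma SU_inverse:
  assumes "z \<in> SU"
  shows "z ** iadj z = mat 1" "iadj z ** z = mat 1"
  using assms SU_iff matrix_left_right_inverse by blast+

lemma SU_cancel:
  assumes "z \<in> SU"
  shows "z ** (iadj z ** A) = A" "iadj z ** (z ** A) = A"
    "A ** iadj z ** z = A" "A ** z ** iadj z = A"
     apply (simp_all only: matrix_mul_assoc SU_inverse[OF assms] matrix_mul_lid)
   apply (simp_all only: SU_inverse[OF assms] matrix_mul_rid flip: matrix_mul_assoc)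
  done

lemma matrix_inv_SU:
  assumes "z \<in> SU"
  shows "matrix_inv z = iadj z"
proof -
  have "z ** matrix_inv z = mat 1 \<and> matrix_inv z ** z = mat 1"
    unfolding matrix_inv_def by (rule someI[of _ "iadj z"]) (simp add: SU_inverse[OF assms])
  then show ?thesis
    by (metis SU_cancel(2)[OF assms] matrix_mul_rid)
qed

lemma su_algebra_iff: "Z \<in> su_algebra \<longleftrightarrow> trace Z = 0 \<and> iadj Z = - Z"
proof -
  have "Z ** I_pq + I_pq ** adjoint_matrix Z = 0 \<longleftrightarrow> (Z ** I_pq + I_pq ** adjoint_matrix Z) ** I_pq = 0"
    using matrix_mul_assoc[of "Z ** I_pq + I_pq ** adjoint_matrix Z" I_pq I_pq] by auto
  also have "\<dots> \<longleftrightarrow> Z + iadj Z = 0"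
    by (simp add: matrix_add_rdistrib iadj_def flip: matrix_mul_assoc)
  finally show ?thesis
    by (auto simp: su_algebra_def add_eq_0_iff)
qed

lemma subspace_su_algebra: "subspace su_algebra"
  unfolding subspace_def Ball_def su_algebra_iff
  by (auto simp add: trace_linear_simps iadj_linear_simps)

lemma SU_tangent_iff:
  assumes "x \<in> SU"
  shows "X \<in> SU_tangent x \<longleftrightarrow> iadj x ** X \<in> su_algebra"
  by (auto simp: SU_tangent_def image_iff SU_cancel(2)[OF assms])
     (use SU_cancel(1)[OF assms, of X] in force)

lemma SU_tangent_mult: "Z \<in> su_algebra \<Longrightarrow> x ** Z \<in> SU_tangent x"
  unfolding SU_tangent_def by blast

text \<open>The rule for the derivative of the inverse: since \<open>iadj\<close> is linear,
  \<open>iadj X\<close> is the derivative of inversion in direction \<open>X\<close>.\<close>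

lemma iadj_tangent:
  assumes "x \<in> SU" "X \<in> SU_tangent x"
  shows "iadj X ** x = - (iadj x ** X)" "iadj X = - (iadj x ** X ** iadj x)"
proof -
  have "iadj (iadj x ** X) = - (iadj x ** X)"
    using assms SU_tangent_iff su_algebra_iff by blast
  then show *: "iadj X ** x = - (iadj x ** X)" by (simp add: iadj_mult)
  show "iadj X = - (iadj x ** X ** iadj x)"
    using SU_cancel(4)[OF assms(1), of "iadj X"] * by (simp add: matrix_mult.minus_left)
qed

lemma subspace_SU_tangent: "subspace (SU_tangent x)"
proof -
  have "linear (\<lambda>Z. x ** Z)"
    unfolding linear_iff by (simp add: matrix_mult.add_right matrix_mult.scaleR_right)
  then show ?thesis
    unfolding SU_tangent_def using subspace_su_algebra by (rule linear_subspace_image)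
qed

text \<open>The projection onto the \<open>-1\<close> eigenspace of \<open>iadj\<close> along the
  \<open>+1\<close> eigenspace; on trace-free matrices this is the projection onto
  \<open>su_algebra\<close> along \<open>\<i>\<close> times it.\<close>

definition su_proj :: "('p::finite, 'q::finite) cmat \<Rightarrow> ('p, 'q) cmat" where
  "su_proj W = (1/2) *\<^sub>R (W - iadj W)"

lemma linear_su_proj: "linear su_proj"
  unfolding su_proj_def[abs_def] linear_iff
  by (simp add: iadj_linear_simps algebra_simps)

lemmas su_proj_linear_simps =
  linear_0[OF linear_su_proj] linear_add[OF linear_su_proj] linear_diff[OF linear_su_proj]
  linear_neg[OF linear_su_proj] linear_scale[OF linear_su_proj]

lemma su_proj_in_su_algebra: "trace W = 0 \<Longrightarrow> su_proj W \<in> su_algebra"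
  by (simp add: su_algebra_iff su_proj_def trace_linear_simps trace_iadj iadj_linear_simps
      flip: scaleR_minus_right)

lemma su_proj_fix: "Z \<in> su_algebra \<Longrightarrow> su_proj Z = Z"
  by (simp add: su_algebra_iff su_proj_def flip: scaleR_2)

lemma mat_ii_mult: "mat \<i> ** (mat \<i> ** A) = - (A :: complex^'n^'m)"
  by (simp add: vec_eq_iff mat_mult_nth)

text \<open>
  The splitting of \<open>sl\<^sub>n(\<complex>)\<close> as \<open>su(p,q) + i su(p,q)\<close>.
\<close>

lemma su_proj_decomp: "su_proj W + mat \<i> ** su_proj (- (mat \<i> ** W)) = W"
proof -
  have "iadj (- (mat \<i> ** W)) = mat \<i> ** iadj W"
    by (simp add: iadj_linear_simps iadj_mult mat_uminus matrix_mult.minus_right flip: mat_mult_commute)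
  then have "mat \<i> ** su_proj (- (mat \<i> ** W)) = (1/2) *\<^sub>R (W + iadj W)"
    by (simp add: su_proj_def matrix_mult.scaleR_right matrix_mult.diff_right matrix_mult.minus_right mat_ii_mult)
  then show ?thesis by (simp add: su_proj_def flip: scaleR_add_right scaleR_2)
qed

lemma commutator_in_su_algebra:
  assumes "Z \<in> su_algebra" "W \<in> su_algebra"
  shows "Z ** W - W ** Z \<in> su_algebra"
  using assms unfolding su_algebra_iff
  by (simp add: trace_linear_simps trace_mult_commute[of W] iadj_linear_simps iadj_mult matrix_mult.minus_left matrix_mult.minus_right)

section \<open>Nondegeneracy of the metric\<close>

lemma SU_metric_eq:
  assumes "x \<in> SU"
  shows "SU_metric x X Y = - Re (trace (iadj x ** X ** (iadj x ** Y)))"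
  by (simp add: SU_metric_def matrix_inv_SU[OF assms])

text \<open>Supplies the test vectors for nondegeneracy: up to sign this is the Cartan
  involution.\<close>

lemma adjoint_matrix_in_su_algebra:
  assumes "Z \<in> su_algebra"
  shows "adjoint_matrix Z \<in> su_algebra"
proof -
  have "\<And>i j. iadj Z $ j $ i = (- Z) $ j $ i" 
    using assms unfolding su_algebra_iff by simp
  then have *: "eps j * cnj (Z $ i $ j) * eps i = - Z $ j $ i" for i j
    by (simp add: iadj_nth)
  have "eps i * Z $ i $ j * eps j = - cnj (Z $ j $ i)" for i j
    using arg_cong[OF *[of j i], of cnj] by (simp add: mult_ac)
  moreover have "cnj (trace Z) = 0" using assms su_algebra_iff by auto
  ultimately show ?thesis
    unfolding su_algebra_iff 
    by (simp add: vec_eq_iff iadj_nth adjoint_matrix_def transpose_def trace_def)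
qed

lemma trace_mult_adjoint_eq_0:
  fixes Z :: "complex^'n^'n"
  assumes "Re (trace (Z ** adjoint_matrix Z)) = 0"
  shows "Z = 0"
proof -
  have "(\<Sum>i\<in>UNIV. \<Sum>j\<in>UNIV. (cmod (Z $ i $ j))\<^sup>2) = 0"
    using assms
    by (simp add: trace_def matrix_matrix_mult_def adjoint_matrix_def transpose_def complex_norm_square[symmetric]
        flip: of_real_power)
  then have "\<forall>i j. Z $ i $ j = 0"
    by (simp add: sum_nonneg_eq_0_iff sum_nonneg)
  then show ?thesis by (simp add: vec_eq_iff)
qed

text \<open>As the metric is indefinite, \<open>V = x Z\<close> is paired not with itself but with
  \<open>x\<close> times the adjoint of \<open>Z\<close>. This gives minus the sum of the squared
  moduli of the entries of \<open>Z\<close>.\<close>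

lemma SU_metric_nondegenerate:
  assumes "x \<in> SU" "V \<in> SU_tangent x" "\<And>X. X \<in> SU_tangent x \<Longrightarrow> SU_metric x V X = 0"
  shows "V = 0"
proof -
  let ?Z = "iadj x ** V"
  have Z: "?Z \<in> su_algebra" using assms SU_tangent_iff by blast
  have "SU_metric x V (x ** adjoint_matrix ?Z) = 0"
    by (rule assms(3)[OF SU_tangent_mult[OF adjoint_matrix_in_su_algebra[OF Z]]])
  then have "?Z = 0"
    by (intro trace_mult_adjoint_eq_0) (simp add: SU_metric_eq[OF assms(1)] SU_cancel[OF assms(1)])
  then show ?thesis using SU_cancel(1)[OF assms(1), of V] by simp
qed

lemma SU_metric_commute: "SU_metric x X Y = SU_metric x Y X"
  by (simp add: SU_metric_def trace_mult_commute[of "_ ** X"])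

section \<open>Straight lines in the group\<close>

text \<open>Conjugation by a matrix \<open>P\<close> whose column \<open>k\<close> is
  \<open>u\<close> turns \<open>u\<close> into a basis vector, and then only one row differs from
  the identity. Cramer's lemma evaluates both determinants.\<close>

lemma det_mat_1_plus_outer:
  fixes u w :: "complex^'n"
  shows "det (mat 1 + outer u w) = 1 + (\<Sum>i\<in>UNIV. w $ i * u $ i)"
proof (cases "u = 0")
  case True
  then have "outer u w = 0" by (simp add: outer_def vec_eq_iff)
  then show ?thesis using True by simp
next
  case False
  then obtain k where k: "u $ k \<noteq> 0" by (auto simp: vec_eq_iff)
  define P :: "complex^'n^'n" where "P = (\<chi> i j. if j = k then u $ i else mat 1 $ i $ j)"
  define w' where "w' = (\<chi> j. \<Sum>i\<in>UNIV. w $ i * P $ i $ j)"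
  define Q :: "complex^'n^'n" where "Q = mat 1 + outer (axis k 1) w'"
  have detP: "det P = u $ k"
    using cramer_lemma[of k "mat 1" u] by (simp add: P_def cong: if_cong)
  have "Q = (\<chi> i. if i = k then \<Sum>i\<in>UNIV. (axis k 1 + w') $ i *s row i (mat 1) else row i (mat 1))"
    by (auto simp: Q_def outer_def vec_eq_iff axis_def mat_def row_def sum_component if_distrib cong: if_cong)
  then have detQ: "det Q = 1 + w' $ k"
    using cramer_lemma_transpose[of k "axis k 1 + w'" "mat 1"] by (simp add: axis_def)
  have "w' $ k = (\<Sum>i\<in>UNIV. w $ i * u $ i)"
    by (simp add: w'_def P_def)
  moreover have "(mat 1 + outer u w) ** P = P ** Q"
  proof -
    have "outer u w ** P = outer u w'"
      by (simp add: vec_eq_iff outer_def w'_def matrix_matrix_mult_def sum_distrib_left mult.assoc)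
    moreover have "P ** outer (axis k 1) w' = outer u w'"
      by (simp add: vec_eq_iff outer_def matrix_matrix_mult_def P_def axis_def if_distrib if_distribR cong: if_cong)
    ultimately show ?thesis
      by (simp add: Q_def matrix_mult.add_left matrix_mult.add_right)
  qed
  then have "det (mat 1 + outer u w) * det P = det P * det Q"
    by (metis det_mul)
  ultimately show ?thesis using k detP detQ by simp
qed

lemma sum_mult_axis: "(\<Sum>j\<in>UNIV. g j * axis k b $ j) = g k * b" for b :: "'a::comm_semiring_1"
proof -
  have "(\<Sum>j\<in>UNIV. g j * axis k b $ j) = (\<Sum>j\<in>UNIV. if j = k then g k * b else 0)"
    by (rule sum.cong) (auto simp: axis_def)
  then show ?thesis by simp
qed

definition null_vector :: "complex^('p::finite + 'q::finite) \<Rightarrow> bool" where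
  "null_vector \<xi> \<longleftrightarrow> (\<Sum>i\<in>UNIV. eps i * \<xi> $ i * cnj (\<xi> $ i)) = 0"

definition null_gen :: "complex^('p::finite + 'q::finite) \<Rightarrow> ('p, 'q) cmat" where
  "null_gen \<xi> = (\<chi> i j. \<i> * \<xi> $ i * cnj (\<xi> $ j) * eps j)"

lemma null_gen_in_su_algebra:
  assumes "null_vector \<xi>"
  shows "null_gen \<xi> \<in> su_algebra"
proof -
  have "trace (null_gen \<xi>) = \<i> * (\<Sum>i\<in>UNIV. eps i * \<xi> $ i * cnj (\<xi> $ i))"
    unfolding trace_def null_gen_def by (simp add: sum_distrib_left mult_ac)
  moreover have "iadj (null_gen \<xi>) = - null_gen \<xi>"
    by (simp add: vec_eq_iff iadj_nth null_gen_def mult_ac)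
  ultimately show ?thesis
    using assms by (simp add: su_algebra_iff null_vector_def)
qed

lemma null_gen_square:
  assumes "null_vector \<xi>"
  shows "null_gen \<xi> ** null_gen \<xi> = 0"
proof -
  have "(null_gen \<xi> ** null_gen \<xi>) $ i $ j
      = - \<xi> $ i * cnj (\<xi> $ j) * eps j * (\<Sum>k\<in>UNIV. eps k * \<xi> $ k * cnj (\<xi> $ k))" for i j
    unfolding matrix_matrix_mult_def sum_distrib_left
    by (auto simp: null_gen_def algebra_simps intro!: sum.cong)
  then show ?thesis using assms by (simp add: vec_eq_iff null_vector_def)
qed

text \<open>The determinant of \<open>1 + t Z\<close> is \<open>1 + t\<close> times the trace of
  \<open>Z\<close>, since \<open>Z\<close> has rank at most one, and this trace vanishes. The
  inverse is \<open>1 - t Z\<close> because \<open>Z\<close> squares to zero.\<close>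

lemma SU_line:
  assumes "x \<in> SU" "null_vector \<xi>"
  shows "x + t *\<^sub>R (x ** null_gen \<xi>) \<in> SU"
proof -
  let ?Z = "null_gen \<xi>"
  let ?E = "mat 1 + t *\<^sub>R ?Z"
  have "t *\<^sub>R ?Z = outer (\<chi> i. t *\<^sub>R (\<i> * \<xi> $ i)) (\<chi> j. cnj (\<xi> $ j) * eps j)"
    by (simp add: vec_eq_iff outer_def null_gen_def mult.assoc)
  then have "det ?E = 1 + (\<Sum>i\<in>UNIV. cnj (\<xi> $ i) * eps i * t *\<^sub>R (\<i> * \<xi> $ i))"
    by (simp add: det_mat_1_plus_outer)
  also have "\<dots> = 1 + t *\<^sub>R (\<i> * (\<Sum>i\<in>UNIV. eps i * \<xi> $ i * cnj (\<xi> $ i)))"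
    by (simp add: sum_distrib_left scaleR_sum_right mult_ac)
  finally have det: "det ?E = 1" using assms(2) by (simp add: null_vector_def)
  have "iadj ?E = mat 1 - t *\<^sub>R ?Z"
    using null_gen_in_su_algebra[OF assms(2)] by (simp add: iadj_linear_simps su_algebra_iff)
  then have "?E ** iadj ?E = mat 1"
    using null_gen_square[OF assms(2)]
    by (simp add: matrix_mult.add_left matrix_mult.diff_right matrix_mult.scaleR_left matrix_mult.scaleR_right)
  moreover have "x ** ?E ** iadj (x ** ?E) = x ** (?E ** iadj ?E) ** iadj x"
    by (simp only: iadj_mult matrix_mul_assoc)
  ultimately have "x ** ?E ** iadj (x ** ?E) = x ** iadj x"
    by simp
  then have "x ** ?E \<in> SU"
    using assms(1) det by (simp add: SU_iff det_mul)
  then show ?thesis by (simp add: matrix_mult.add_right matrix_mult.scaleR_right)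
qed

text \<open>The hypothesis says that the skew-Hermitian form of \<open>Y I_pq\<close> vanishes on
  all null vectors. Null vectors with two or three non-zero entries force \<open>Y\<close> to be a
  scalar matrix, and the trace condition makes it zero.\<close>

lemma su_algebra_orthogonal_null_gen_imp_0:
  fixes Y :: "('p::finite, 'q::finite) cmat"
  assumes Y: "Y \<in> su_algebra" and orth: "\<And>\<xi>. null_vector \<xi> \<Longrightarrow> Y \<bullet> null_gen \<xi> = 0"
  shows "Y = 0"
proof -
  define H where "H i j = Y $ i $ j * eps j" for i j
  define s where "s \<xi> \<eta> = (\<Sum>i\<in>UNIV. \<Sum>j\<in>UNIV. cnj (\<xi> $ i) * H i j * \<eta> $ j)" for \<xi> \<eta> :: "complex^('p + 'q)"
  define n where "n \<xi> \<eta> = (\<Sum>i\<in>UNIV. eps i * \<xi> $ i * cnj (\<eta> $ i))" for \<xi> \<eta> :: "complex^('p + 'q)"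
  have "iadj Y $ i $ j = - Y $ i $ j" for i j
    using Y by (simp add: su_algebra_iff)
  then have Yij: "Y $ i $ j = - (eps i * cnj (Y $ j $ i) * eps j)" for i j
    by (simp add: iadj_nth)
  have skew: "H j i = - cnj (H i j)" for i j
    unfolding H_def by (subst Yij) (simp add: mult_ac)
  \<comment> \<open>Entrywise form of the next identity. As \<open>H\<close> is skew-Hermitian,
    \<open>s \<xi> \<xi>\<close> is purely imaginary, so its imaginary part carries all the
    information.\<close>
  have inner_i: "y \<bullet> (\<i> * w) = Im (cnj w * y)" for y w :: complex
    by (simp add: inner_complex_def)
  have "Y \<bullet> null_gen \<xi> = Im (s \<xi> \<xi>)" for \<xi>
    by (simp add: s_def inner_vec_def null_gen_def mult.assoc inner_i H_def Im_sum del: times_complex.sel)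
       (simp add: mult_ac del: times_complex.sel)
  then have Im_s: "Im (s \<xi> \<xi>) = 0" if "n \<xi> \<xi> = 0" for \<xi>
    using orth[of \<xi>] that by (simp add: null_vector_def n_def)
  have s_add: "s (\<xi> + \<xi>') \<eta> = s \<xi> \<eta> + s \<xi>' \<eta>" "s \<eta> (\<xi> + \<xi>') = s \<eta> \<xi> + s \<eta> \<xi>'" for \<xi> \<xi>' \<eta>
    by (simp_all add: s_def distrib_left distrib_right sum.distrib)
  have n_add: "n (\<xi> + \<xi>') \<eta> = n \<xi> \<eta> + n \<xi>' \<eta>" "n \<eta> (\<xi> + \<xi>') = n \<eta> \<xi> + n \<eta> \<xi>'" for \<xi> \<xi>' \<eta>
    by (simp_all add: n_def distrib_left distrib_right sum.distrib)
  have s_axis: "s (axis i a) (axis j b) = cnj a * H i j * b" for i j a b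
  proof -
    have "s (axis i a) (axis j b) = (\<Sum>k\<in>UNIV. cnj (axis i a $ k) * H k j * b)"
      by (simp only: s_def sum_mult_axis)
    also have "\<dots> = (\<Sum>k\<in>UNIV. (H k j * b) * axis i (cnj a) $ k)"
      by (rule sum.cong) (auto simp: axis_def)
    finally show ?thesis unfolding sum_mult_axis by (simp add: mult_ac)
  qed
  have n_axis: "n (axis i a) (axis j b) = (if i = j then eps i * a * cnj b else 0)" for i j a b
  proof -
    have "n (axis i a) (axis j b) = (\<Sum>k\<in>UNIV. (eps k * axis i a $ k) * axis j (cnj b) $ k)"
      unfolding n_def by (rule sum.cong) (auto simp: axis_def)
    then show ?thesis unfolding sum_mult_axis by (auto simp: axis_def)
  qed
  have diag: "Re (H i i) = 0" for i
    using arg_cong[OF skew[of i i], of Re] by simp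
  have off: "H i j = 0" "H i i = - H j j" if "eps i = - eps j" for i j
  proof -
    have ij: "i \<noteq> j" using that by auto
    \<comment> \<open>The test vector has entries \<open>1\<close> and \<open>b\<close> at indices
      of opposite sign. The values \<open>1\<close> and \<open>-1\<close> of \<open>b\<close>
      separate the diagonal from the imaginary part of \<open>H i j\<close>; the value
      \<open>\<i>\<close> gives the real part.\<close>
    have unit: "Im (H i i) + Im (H j j) + Im (b * H i j) + Im (cnj b * H j i) = 0" if "b * cnj b = 1" for b
    proof -
      have c: "cnj b * H j j * b = H j j" using that by (simp add: mult_ac)
      have "s (axis i 1 + axis j b) (axis i 1 + axis j b) = H i i + H j j + b * H i j + cnj b * H j i"
        unfolding s_add s_axis c by simp
      moreover have "Im (s (axis i 1 + axis j b) (axis i 1 + axis j b)) = 0"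
        by (rule Im_s) (use ij that \<open>eps i = - eps j\<close> in \<open>simp add: n_add n_axis mult.assoc\<close>)
      ultimately show ?thesis by (metis plus_complex.sel(2))
    qed
    have "Im (H i i) + Im (H j j) = 0" "Im (H i j) = 0" "Re (H i j) = 0"
      using unit[of 1] unit[of "-1"] unit[of \<i>] skew[of i j] by simp_all
    then show "H i j = 0" "H i i = - H j j"
      using diag[of i] diag[of j] by (simp_all add: complex_eq_iff)
  qed
  \<comment> \<open>Both index types are inhabited, which encodes \<open>p, q \<ge> 1\<close>. A
    definite form would have no non-zero null vectors.\<close>
  have opposite: "\<exists>j :: 'p + 'q. eps i = - eps j" for i :: "'p + 'q"
    by (cases i) (metis eps_simps(1,2) minus_minus)+
  have off': "H i k = 0" if "i \<noteq> k" "eps i = eps k" for i k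
  proof -
    obtain j :: "'p + 'q" where j: "eps i = - eps j" using opposite by blast
    then have ne: "i \<noteq> j" "k \<noteq> j" using that by auto
    have z: "H i j = 0" "H k j = 0" "H j i = 0" "H j k = 0" "H i i = - H j j" "H k k = - H j j"
      using off[of i j] off[of k j] skew[of i j] skew[of k j] j that by auto
    have "Im (c * H i k) + Im (cnj c * H k i) = 0" if "c * cnj c = 1" for c
    proof -
      \<comment> \<open>The entry \<open>sqrt 2\<close> at an index of opposite sign balances the
        two unit entries at \<open>i\<close> and \<open>k\<close>. The diagonal contributions cancel
        in the same way.\<close>
      let ?r = "complex_of_real (sqrt 2)"
      have r: "?r * ?r = 2" by (simp flip: of_real_mult)
      let ?\<xi> = "axis i 1 + axis k c + axis j ?r"
      have c: "cnj c * H k k * c = H k k" using that by (simp add: mult_ac)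
      have r': "cnj ?r * H j j * ?r = 2 * H j j" using r by (simp add: mult_ac)
      have "s ?\<xi> ?\<xi> = c * H i k + cnj c * H k i"
        unfolding s_add s_axis c r' by (simp add: z)
      moreover have "Im (s ?\<xi> ?\<xi>) = 0"
        by (rule Im_s)
           (use ne that \<open>i \<noteq> k\<close> \<open>eps i = eps k\<close>[symmetric] j r in \<open>simp add: n_add n_axis mult.assoc\<close>)
      ultimately show ?thesis by (metis plus_complex.sel(2))
    qed
    from this[of 1] this[of \<i>] show ?thesis
      using skew[of i k] by (simp add: complex_eq_iff)
  qed
  have eps2: "eps i = eps k \<or> eps i = - eps k" for i k :: "'p + 'q"
    by (cases i; cases k) simp_all
  have Y_H: "Y $ i $ j = H i j * eps j" for i j by (simp add: H_def)
  have YO: "Y $ i $ k = 0" if "i \<noteq> k" for i k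
    using off(1)[of i k] off'[of i k] eps2[of i k] that by (auto simp: Y_H)
  have D: "Y $ i $ i = Y $ j $ j" if "eps i = - eps j" for i j
    using off(2)[OF that] that by (simp add: Y_H)
  have YD: "Y $ i $ i = Y $ k $ k" for i k
  proof -
    obtain j :: "'p + 'q" where j: "eps k = - eps j" using opposite by blast
    show ?thesis
      using eps2[of i k] D[of i k] D[of i j] D[of k j] j by auto
  qed
  have "Y $ i $ i = 0" for i
  proof -
    have "trace Y = of_nat CARD('p + 'q) * Y $ i $ i"
      unfolding trace_def by (subst YD[of _ i]) simp
    moreover have "trace Y = 0" using Y su_algebra_iff by blast
    moreover have "(of_nat CARD('p + 'q) :: complex) \<noteq> 0"
      unfolding of_nat_eq_0_iff by simp
    ultimately show ?thesis by (metis mult_eq_0_iff)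
  qed
  then have "Y $ i $ j = 0" for i j using YO by (cases "i = j") auto
  then show ?thesis by (simp add: vec_eq_iff)
qed

text \<open>The component of \<open>Y\<close> orthogonal to the span, in the Euclidean inner
  product, stays in \<open>su_algebra\<close> and is orthogonal to all generators, so the preceding
  lemma kills it.\<close>

lemma span_null_gen:
  "span (null_gen ` Collect null_vector) = (su_algebra :: ('p::finite, 'q::finite) cmat set)" (is "span ?S = _")
proof
  show sub: "span ?S \<subseteq> su_algebra"
    by (rule span_minimal[OF _ subspace_su_algebra]) (auto intro: null_gen_in_su_algebra)
  show "su_algebra \<subseteq> span ?S"
  proof
    fix Y :: "('p, 'q) cmat" assume Y: "Y \<in> su_algebra"
    obtain y z where yz: "y \<in> span ?S" "\<And>w. w \<in> span ?S \<Longrightarrow> orthogonal z w" "Y = y + z"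
      using orthogonal_subspace_decomp_exists[of ?S Y] by metis
    have "z = Y - y" using yz(3) by simp
    then have "z \<in> su_algebra"
      using Y yz(1) sub by (auto intro: subspace_diff[OF subspace_su_algebra])
    moreover have "z \<bullet> null_gen \<xi> = 0" if "null_vector \<xi>" for \<xi>
      using yz(2)[of "null_gen \<xi>"] that by (simp add: orthogonal_def span_base)
    ultimately have "z = 0" by (rule su_algebra_orthogonal_null_gen_imp_0)
    then show "Y \<in> span ?S" using yz by simp
  qed
qed

text \<open>Composition with the line gives a function on all of the reals, where derivatives are
  unique.\<close>

lemma has_derivative_within_unique_along_line:
  assumes f': "(f has_derivative f') (at x within S)" and f'': "(f has_derivative f'') (at x within S)"
    and line: "\<And>t. x + t *\<^sub>R X \<in> S"
  shows "f' X = f'' X"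
proof -
  have "((\<lambda>t::real. f (x + t *\<^sub>R X)) has_derivative (\<lambda>t. g (t *\<^sub>R X))) (at 0)"
    if "(f has_derivative g) (at x within S)" for g
  proof -
    have "((\<lambda>t. x + t *\<^sub>R X) has_derivative (\<lambda>t. t *\<^sub>R X)) (at 0)"
      by (auto intro!: derivative_eq_intros)
    moreover have "(f has_derivative g) (at (x + 0 *\<^sub>R X) within range (\<lambda>t. x + t *\<^sub>R X))"
      using has_derivative_subset[OF that, of "range (\<lambda>t. x + t *\<^sub>R X)"] line by auto
    ultimately show ?thesis
      using has_derivative_in_compose by blast
  qed
  from has_derivative_unique[OF this[OF f'] this[OF f'']] show ?thesis
    by (metis scaleR_one)
qed

text \<open>Any two derivatives within the group agree along the lines of \<open>SU_line\<close>.
  Their directions span the tangent space by \<open>span_null_gen\<close>, and linearity does the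
  rest.\<close>

lemma mfd_deriv_SU:
  assumes f': "(f has_derivative f') (at x within SU)" and x: "x \<in> SU" and X: "X \<in> SU_tangent x"
  shows "mfd_deriv SU f x X = f' X"
proof -
  let ?D = "frechet_derivative f (at x within SU)"
  have D: "(f has_derivative ?D) (at x within SU)"
    using f' differentiableI frechet_derivative_works by blast
  obtain Z where Z: "Z \<in> su_algebra" "X = x ** Z" using X by (auto simp: SU_tangent_def)
  interpret D: linear ?D using D has_derivative_linear by blast
  interpret f': linear f' using f' has_derivative_linear by blast
  have "Z \<in> span (null_gen ` Collect null_vector)" using Z span_null_gen by blast
  then have "?D (x ** Z) = f' (x ** Z)"
  proof (induction rule: span_induct_alt)
    case base
    then show ?case by (simp add: D.zero f'.zero)
  next
    case (step c y W)
    then have "?D (x ** y) = f' (x ** y)"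
      using has_derivative_within_unique_along_line[OF D f'] SU_line[OF x] by blast
    then show ?case
      using step by (simp add: matrix_mult.add_right matrix_mult.scaleR_right D.add f'.add D.scale f'.scale)
  qed
  then show ?thesis using Z by (simp add: mfd_deriv_def)
qed

section \<open>The Levi-Civita connection\<close>

abbreviation (input) SU_fields :: "(('p::finite, 'q::finite) cmat \<Rightarrow> ('p, 'q) cmat) set" where
  "SU_fields \<equiv> vector_fields SU SU_tangent"

lemma SU_fieldsD:
  assumes "Y \<in> SU_fields"
  shows "smooth_on_mfd SU Y" "x \<in> SU \<Longrightarrow> Y x \<in> SU_tangent x"
  using assms by (auto simp: vector_fields_def)

lemma mfd_deriv_SU_cong:
  assumes "\<And>y. y \<in> SU \<Longrightarrow> f y = g y" "(g has_derivative g') (at x within SU)" "x \<in> SU" "X \<in> SU_tangent x"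
  shows "mfd_deriv SU f x X = g' X"
  by (rule mfd_deriv_SU[OF has_derivative_transform[OF assms(3,1,2)] assms(3,4)])

lemma has_derivative_left_trivialization:
  assumes "Y \<in> SU_fields" "x \<in> SU"
  shows "((\<lambda>y. iadj y ** Y y) has_derivative
           (\<lambda>h. iadj x ** mfd_deriv SU Y x h + iadj h ** Y x)) (at x within SU)"
  by (intro matrix_mult.FDERIV bounded_linear_imp_has_derivative bounded_linear_iadj
      smooth_on_mfd_has_derivative SU_fieldsD(1) assms)

lemma mfd_deriv_left_trivialization:
  assumes "Y \<in> SU_fields" "x \<in> SU" "X \<in> SU_tangent x"
  shows "mfd_deriv SU (\<lambda>y. iadj y ** Y y) x X
       = iadj x ** mfd_deriv SU Y x X - iadj x ** X ** (iadj x ** Y x)"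
  unfolding mfd_deriv_SU[OF has_derivative_left_trivialization[OF assms(1,2)] assms(2,3)]
    iadj_tangent(2)[OF assms(2,3)]
  by (simp add: matrix_mult.minus_left flip: matrix_mul_assoc)

text \<open>The linear equations defining \<open>su_algebra\<close> hold for
  \<open>iadj y ** Y y\<close> at every \<open>y\<close> in the group, so they may be
  differentiated.\<close>

lemma mfd_deriv_left_trivialization_in_su_algebra:
  assumes "Y \<in> SU_fields" "x \<in> SU" "X \<in> SU_tangent x"
  shows "mfd_deriv SU (\<lambda>y. iadj y ** Y y) x X \<in> su_algebra"
proof -
  let ?\<eta> = "\<lambda>y. iadj y ** Y y"
  let ?\<eta>' = "\<lambda>h. iadj x ** mfd_deriv SU Y x h + iadj h ** Y x"
  have \<eta>: "?\<eta> y \<in> su_algebra" if "y \<in> SU" for y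
    using SU_fieldsD(2)[OF assms(1) that] SU_tangent_iff[OF that] by blast
  note d = has_derivative_left_trivialization[OF assms(1,2)]
  \<comment> \<open>The derivative of the zero function is computed twice: through a defining
    equation, and as that of a constant.\<close>
  have "mfd_deriv SU (\<lambda>y. 0 :: complex) x X = trace (?\<eta>' X)"
    by (rule mfd_deriv_SU_cong[OF _ bounded_linear.has_derivative[OF bounded_linear_trace d] assms(2,3)])
       (use \<eta>[unfolded su_algebra_iff] in auto)
  moreover have "mfd_deriv SU (\<lambda>y. 0 :: ('a, 'b) cmat) x X = ?\<eta>' X + iadj (?\<eta>' X)"
    by (rule mfd_deriv_SU_cong[OF _ has_derivative_add[OF d bounded_linear.has_derivative[OF bounded_linear_iadj d]] assms(2,3)])
       (use \<eta>[unfolded su_algebra_iff] in auto)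
  moreover have "mfd_deriv SU (\<lambda>y. 0 :: complex) x X = 0" "mfd_deriv SU (\<lambda>y. 0 :: ('a, 'b) cmat) x X = 0"
    by (rule mfd_deriv_SU[OF has_derivative_const assms(2,3)])+
  ultimately have "trace (?\<eta>' X) = 0" "?\<eta>' X + iadj (?\<eta>' X) = 0"
    by simp_all
  then have "?\<eta>' X \<in> su_algebra"
    unfolding su_algebra_iff using minus_unique by metis
  then show ?thesis using mfd_deriv_SU[OF d assms(2,3)] by simp
qed

text \<open>
  In the left trivialization \<open>\<eta> = x\<^sup>-\<^sup>1 Y\<close>, \<open>\<xi> = x\<^sup>-\<^sup>1 X\<close> this is the usual connection
  \<open>d\<eta>(X) + [\<xi>, \<eta>]/2\<close> of a bi-invariant metric.
\<close>

definition SU_connection ::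
  "(('p::finite, 'q::finite) cmat \<Rightarrow> ('p, 'q) cmat) \<Rightarrow> ('p, 'q) cmat \<Rightarrow> ('p, 'q) cmat \<Rightarrow> ('p, 'q) cmat" where
  "SU_connection Y x X =
     mfd_deriv SU Y x X - (1/2) *\<^sub>R (X ** (iadj x ** Y x) + Y x ** (iadj x ** X))"

text \<open>Passing from \<open>Y\<close> to its trivialization costs one product of the trivialized
  \<open>X\<close> and \<open>Y\<close>; combined with half the symmetrized product in
  \<open>SU_connection\<close> this leaves half a commutator.\<close>

lemma SU_connection_left_trivialization:
  assumes "Y \<in> SU_fields" "x \<in> SU" "X \<in> SU_tangent x"
  shows "iadj x ** SU_connection Y x X =
    mfd_deriv SU (\<lambda>y. iadj y ** Y y) x X
      + (1/2) *\<^sub>R (iadj x ** X ** (iadj x ** Y x) - iadj x ** Y x ** (iadj x ** X))"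
proof -
  have half: "A - (1/2) *\<^sub>R (B + C) = A - B + (1/2) *\<^sub>R (B - C)" for A B C :: "('a, 'b) cmat"
  proof -
    have "B = (1/2) *\<^sub>R B + (1/2) *\<^sub>R B" by (simp flip: scaleR_add_left)
    then show ?thesis by (simp add: algebra_simps)
  qed
  show ?thesis
    unfolding mfd_deriv_left_trivialization[OF assms] SU_connection_def half[symmetric]
    by (simp add: matrix_mult.diff_right matrix_mult.scaleR_right matrix_mult.add_right matrix_mul_assoc)
qed

lemma SU_connection_tangent:
  assumes "Y \<in> SU_fields" "x \<in> SU" "X \<in> SU_tangent x"
  shows "SU_connection Y x X \<in> SU_tangent x"
  unfolding SU_tangent_iff[OF assms(2)] SU_connection_left_trivialization[OF assms]
  using SU_fieldsD(2)[OF assms(1,2)] assms(3) SU_tangent_iff[OF assms(2)]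
  by (intro subspace_add[OF subspace_su_algebra] subspace_scale[OF subspace_su_algebra]
      mfd_deriv_left_trivialization_in_su_algebra assms commutator_in_su_algebra) auto

lemma smooth_SU_connection:
  assumes "X \<in> SU_fields" "Y \<in> SU_fields"
  shows "smooth_on_mfd SU (\<lambda>x. SU_connection Y x (X x))"
proof -
  have XY: "smooth_on_mfd SU X" "smooth_on_mfd SU Y" using assms SU_fieldsD by auto
  have "smooth_on_mfd SU (\<lambda>x. mfd_deriv SU Y x (X x))"
    by (rule smooth_on_mfd_directional_derivative[OF _ XY(2,1)])
       (auto intro: mfd_deriv_SU SU_fieldsD(2)[OF assms(1)])
  moreover have "smooth_on_mfd SU (\<lambda>x. (- (1/2)) *\<^sub>R (X x ** (iadj x ** Y x) + Y x ** (iadj x ** X x)))"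
    by (intro smooth_on_mfd_compose_bounded_linear[OF bounded_linear_scaleR_right]
        smooth_on_mfd_add smooth_on_mfd_bounded_bilinear[OF bounded_bilinear_matrix_mult]
        smooth_on_mfd_bounded_linear[OF bounded_linear_iadj] XY)
  ultimately show ?thesis
    unfolding SU_connection_def using smooth_on_mfd_add by fastforce
qed

lemma affine_connection_SU_connection: "affine_connection SU SU_tangent SU_connection"
  unfolding affine_connection_def
proof (intro conjI ballI allI impI)
  fix Y :: "('p::finite, 'q::finite) cmat \<Rightarrow> ('p, 'q) cmat" and x X X' :: "('p, 'q) cmat" and c d
  assume "Y \<in> SU_fields" "x \<in> SU"
  then interpret linear "mfd_deriv SU Y x"
    using SU_fieldsD smooth_on_mfd_has_derivative has_derivative_linear by blast
  show "SU_connection Y x (c *\<^sub>R X + d *\<^sub>R X') = c *\<^sub>R SU_connection Y x X + d *\<^sub>R SU_connection Y x X'"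
    by (simp add: SU_connection_def add scale matrix_mult.add_left matrix_mult.add_right
        matrix_mult.scaleR_left matrix_mult.scaleR_right scaleR_right_diff_distrib scaleR_add_right mult.commute)
next
  fix X Y :: "('p::finite, 'q::finite) cmat \<Rightarrow> ('p, 'q) cmat"
  assume "X \<in> SU_fields" "Y \<in> SU_fields"
  then show "(\<lambda>x. SU_connection Y x (X x)) \<in> SU_fields"
    using smooth_SU_connection SU_connection_tangent SU_fieldsD(2)
    unfolding vector_fields_def by blast
next
  fix Y Z :: "('p::finite, 'q::finite) cmat \<Rightarrow> ('p, 'q) cmat" and x X :: "('p, 'q) cmat"
  assume *: "Y \<in> SU_fields" "Z \<in> SU_fields" "x \<in> SU" "X \<in> SU_tangent x"
  have "mfd_deriv SU (\<lambda>y. Y y + Z y) x X = mfd_deriv SU Y x X + mfd_deriv SU Z x X"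
    by (rule mfd_deriv_SU[OF has_derivative_add])
       (use * SU_fieldsD smooth_on_mfd_has_derivative in blast)+
  then show "SU_connection (\<lambda>y. Y y + Z y) x X = SU_connection Y x X + SU_connection Z x X"
    by (simp add: SU_connection_def matrix_mult.add_left matrix_mult.add_right algebra_simps)
next
  fix f :: "('p::finite, 'q::finite) cmat \<Rightarrow> real" and Y :: "('p, 'q) cmat \<Rightarrow> ('p, 'q) cmat" and x X :: "('p, 'q) cmat"
  assume *: "smooth_on_mfd SU f" "Y \<in> SU_fields" "x \<in> SU" "X \<in> SU_tangent x"
  have "mfd_deriv SU (\<lambda>y. f y *\<^sub>R Y y) x X = f x *\<^sub>R mfd_deriv SU Y x X + mfd_deriv SU f x X *\<^sub>R Y x"
    by (rule mfd_deriv_SU[OF has_derivative_scaleR])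
       (use * SU_fieldsD smooth_on_mfd_has_derivative in blast)+
  then show "SU_connection (\<lambda>y. f y *\<^sub>R Y y) x X = mfd_deriv SU f x X *\<^sub>R Y x + f x *\<^sub>R SU_connection Y x X"
    by (simp add: SU_connection_def matrix_mult.scaleR_left matrix_mult.scaleR_right algebra_simps)
qed

text \<open>In the left trivialization the metric is the fixed form
  \<open>- Re (trace (Z ** W))\<close>. The commutator terms cancel because this form is
  ad-invariant, by cyclicity of the trace.\<close>

lemma SU_connection_metric:
  assumes "Y \<in> SU_fields" "Z \<in> SU_fields" "x \<in> SU" "X \<in> SU_tangent x"
  shows "mfd_deriv SU (\<lambda>y. SU_metric y (Y y) (Z y)) x X
       = SU_metric x (SU_connection Y x X) (Z x) + SU_metric x (Y x) (SU_connection Z x X)"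
proof -
  let ?\<eta> = "\<lambda>y. iadj y ** Y y" and ?\<zeta> = "\<lambda>y. iadj y ** Z y"
  let ?\<eta>' = "mfd_deriv SU ?\<eta> x X" and ?\<zeta>' = "mfd_deriv SU ?\<zeta> x X"
  note d = has_derivative_left_trivialization[OF assms(1,3)] has_derivative_left_trivialization[OF assms(2,3)]
  have "mfd_deriv SU (\<lambda>y. SU_metric y (Y y) (Z y)) x X
      = - Re (trace (?\<eta> x ** ?\<zeta>' + ?\<eta>' ** ?\<zeta> x))"
    unfolding mfd_deriv_SU[OF d(1) assms(3,4)] mfd_deriv_SU[OF d(2) assms(3,4)]
    by (rule mfd_deriv_SU_cong[OF SU_metric_eq has_derivative_minus[OF bounded_linear.has_derivative[OF bounded_linear_Re
            bounded_linear.has_derivative[OF bounded_linear_trace matrix_mult.FDERIV[OF d]]]] assms(3,4)])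
  moreover have "trace (A ** B ** C) = trace (B ** C ** A)" for A B C :: "('a, 'b) cmat"
    using trace_mult_commute[of A "B ** C"] by (simp add: matrix_mul_assoc)
  then have "trace ((A ** B - B ** A) ** C) + trace (B ** (A ** C - C ** A)) = 0" for A B C :: "('a, 'b) cmat"
    by (simp add: matrix_mult.diff_left matrix_mult.diff_right trace_linear_simps matrix_mul_assoc)
  from arg_cong[OF this[of "iadj x ** X" "?\<eta> x" "?\<zeta> x"], of Re]
  have "Re (trace ((iadj x ** X ** ?\<eta> x - ?\<eta> x ** (iadj x ** X)) ** ?\<zeta> x))
    = - Re (trace (?\<eta> x ** (iadj x ** X ** ?\<zeta> x - ?\<zeta> x ** (iadj x ** X))))"
    by simp
  ultimately show ?thesis
    unfolding SU_metric_eq[OF assms(3)] SU_connection_left_trivialization[OF assms(1,3,4)]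
      SU_connection_left_trivialization[OF assms(2-4)]
    by (simp add: matrix_mult.add_left matrix_mult.add_right matrix_mult.scaleR_left matrix_mult.scaleR_right
        trace_linear_simps)
qed

text \<open>There is no torsion because the algebraic correction in \<open>SU_connection\<close> is
  symmetric in the two fields.\<close>

lemma levi_civita_SU_connection: "levi_civita SU SU_tangent SU_metric SU_connection"
  unfolding levi_civita_def
  by (auto intro: affine_connection_SU_connection SU_connection_metric)
     (simp add: SU_connection_def lie_bracket_def add.commute)

section \<open>Uniqueness of the Levi-Civita connection\<close>

lemma left_invariant_field:
  assumes "x \<in> SU" "X \<in> SU_tangent x"
  shows "(\<lambda>y. y ** (iadj x ** X)) \<in> SU_fields"
  using assms SU_tangent_iff[OF assms(1)]
  by (auto simp: vector_fields_def intro!: smooth_on_mfd_bounded_linear SU_tangent_mult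
      matrix_mult.bounded_linear_left)

lemma SU_metric_diff:
  "SU_metric x (X - X') Y = SU_metric x X Y - SU_metric x X' Y"
  "SU_metric x Y (X - X') = SU_metric x Y X - SU_metric x Y X'"
  by (simp_all add: SU_metric_def matrix_mult.diff_left matrix_mult.diff_right trace_linear_simps)

lemma levi_civitaD:
  assumes "levi_civita M T g D" "Y \<in> vector_fields M T" "Z \<in> vector_fields M T" "x \<in> M"
  shows "(\<lambda>x. D Z x (Y x)) \<in> vector_fields M T"
    and "D Z x (Y x) - D Y x (Z x) = lie_bracket M Y Z x"
    and "X \<in> T x \<Longrightarrow>
      mfd_deriv M (\<lambda>y. g y (Y y) (Z y)) x X = g x (D Y x X) (Z x) + g x (Y x) (D Z x X)"
  using assms unfolding levi_civita_def affine_connection_def by simp_all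

text \<open>
  The difference \<open>S\<close> of two Levi-Civita connections makes \<open>g(S(A, B), C)\<close> symmetric in \<open>A, B\<close> and
  antisymmetric in \<open>B, C\<close>, hence zero.
\<close>

lemma levi_civita_SU_unique:
  fixes D D' :: "(('p::finite, 'q::finite) cmat \<Rightarrow> ('p, 'q) cmat) \<Rightarrow> ('p, 'q) cmat \<Rightarrow> ('p, 'q) cmat \<Rightarrow> ('p, 'q) cmat"
  assumes D: "levi_civita SU SU_tangent SU_metric D" and D': "levi_civita SU SU_tangent SU_metric D'"
    and Y: "Y \<in> SU_fields" and x: "x \<in> SU" and X: "X \<in> SU_tangent x"
  shows "D Y x X = D' Y x X"
proof -
  define S where "S A B = D B x (A x) - D' B x (A x)" for A B
  have tan: "S A B \<in> SU_tangent x" if "A \<in> SU_fields" "B \<in> SU_fields" for A B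
  proof -
    have "(\<lambda>x. D B x (A x)) \<in> SU_fields" "(\<lambda>x. D' B x (A x)) \<in> SU_fields"
      using levi_civitaD(1)[OF _ that x] D D' by simp_all
    then show ?thesis
      unfolding S_def using SU_fieldsD(2)[OF _ x] by (intro subspace_diff[OF subspace_SU_tangent]) fastforce+
  qed
  have sym: "S A B = S B A" if "A \<in> SU_fields" "B \<in> SU_fields" for A B
  proof -
    have "D B x (A x) - D A x (B x) = D' B x (A x) - D' A x (B x)"
      by (simp only: levi_civitaD(2)[OF D that x] levi_civitaD(2)[OF D' that x])
    then show ?thesis unfolding S_def by (simp add: algebra_simps)
  qed
  have skew: "SU_metric x (S A B) (C x) = - SU_metric x (S A C) (B x)"
    if "A \<in> SU_fields" "B \<in> SU_fields" "C \<in> SU_fields" for A B C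
  proof -
    have "A x \<in> SU_tangent x" using SU_fieldsD(2) that x by blast
    from levi_civitaD(3)[OF D that(2,3) x this] levi_civitaD(3)[OF D' that(2,3) x this]
    have "SU_metric x (D B x (A x)) (C x) + SU_metric x (B x) (D C x (A x))
        = SU_metric x (D' B x (A x)) (C x) + SU_metric x (B x) (D' C x (A x))"
      by simp
    then show ?thesis
      unfolding S_def SU_metric_commute[of x _ "B x"] SU_metric_diff by simp
  qed
  \<comment> \<open>The identities for \<open>S\<close> concern vector fields, so the tangent vector
    is extended left-invariantly.\<close>
  define X\<^sub>0 where "X\<^sub>0 = (\<lambda>y :: ('p, 'q) cmat. y ** (iadj x ** X))"
  have X\<^sub>0: "X\<^sub>0 \<in> SU_fields" "X\<^sub>0 x = X"
    using left_invariant_field[OF x X] by (simp_all add: X\<^sub>0_def SU_cancel[OF x])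
  have "S X\<^sub>0 Y = 0"
  proof (rule SU_metric_nondegenerate[OF x tan[OF X\<^sub>0(1) Y]])
    fix Z assume Z: "Z \<in> SU_tangent x"
    define Z\<^sub>0 where "Z\<^sub>0 = (\<lambda>y :: ('p, 'q) cmat. y ** (iadj x ** Z))"
    have Z\<^sub>0: "Z\<^sub>0 \<in> SU_fields" "Z\<^sub>0 x = Z"
      using left_invariant_field[OF x Z] by (simp_all add: Z\<^sub>0_def SU_cancel[OF x])
    \<comment> \<open>Alternating three uses of \<open>sym\<close> with three of \<open>skew\<close>
      returns to the same arguments with the opposite sign.\<close>
    have "SU_metric x (S X\<^sub>0 Y) (Z\<^sub>0 x) = - SU_metric x (S X\<^sub>0 Y) (Z\<^sub>0 x)"
      using skew[OF Y X\<^sub>0(1) Z\<^sub>0(1)] skew[OF Z\<^sub>0(1) Y X\<^sub>0(1)] skew[OF X\<^sub>0(1) Z\<^sub>0(1) Y]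
        sym[OF Y X\<^sub>0(1)] sym[OF Y Z\<^sub>0(1)] sym[OF X\<^sub>0(1) Z\<^sub>0(1)] by simp
    then show "SU_metric x (S X\<^sub>0 Y) Z = 0" using Z\<^sub>0 by simp
  qed
  then show ?thesis using X\<^sub>0 by (simp add: S_def)
qed

text \<open>Existence makes the choice in \<open>divergence\<close> a Levi-Civita connection, and
  uniqueness identifies it with \<open>SU_connection\<close> on tangent vectors.\<close>

lemma divergence_SU:
  assumes "Y \<in> SU_fields" "x \<in> SU"
  shows "divergence SU SU_tangent SU_metric Y x = trace_on (SU_tangent x) (SU_connection Y x)"
  unfolding divergence_def
proof (rule trace_on_cong[OF _ subspace_SU_tangent])
  fix X assume "X \<in> SU_tangent x"
  then show "(SOME D. levi_civita SU SU_tangent SU_metric D) Y x X = SU_connection Y x X"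
    using assms
    by (intro levi_civita_SU_unique[OF someI[of "levi_civita SU SU_tangent SU_metric", OF levi_civita_SU_connection]] levi_civita_SU_connection)
qed

section \<open>Gradient, tension field and conformality operator\<close>

lemma trace_outer_transpose: "trace (outer v a ** transpose z) = trace (outer a v ** z)"
  for z :: "complex^'n^'m"
  by (simp add: trace_def outer_def transpose_def matrix_matrix_mult_def) (subst sum.swap, simp add: mult_ac)

lemma phi_eq: "z \<in> SU \<Longrightarrow> phi v a z = trace (outer a v ** z)"
  by (simp add: phi_def trace_outer_transpose)

lemma outer_vector_scale: "outer (c *s a) v = mat c ** outer a v"
  by (simp add: vec_eq_iff outer_def mat_mult_nth)

lemma trace_outer_vector_scale: "trace (outer (c *s a) v ** A) = c * trace (outer a v ** A)"
  for A :: "complex^'n^'m"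
  by (simp add: outer_vector_scale trace_mat_mult flip: matrix_mul_assoc)

lemma outer_add_left: "outer (a + b) v = outer a v + outer b v"
  by (simp add: vec_eq_iff outer_def distrib_right)

lemma phi_scale: "phi v (c *s a) z = c * phi v a z"
  by (simp add: phi_def trace_outer_transpose trace_outer_vector_scale)

lemma phi_add: "phi v (a + b) z = phi v a z + phi v b z"
  by (simp add: phi_def trace_outer_transpose outer_add_left matrix_add_rdistrib trace_linear_simps)

lemma Im_phi: "Im (phi v a z) = Re (phi v ((- \<i>) *s a) z)"
  by (simp only: phi_scale) simp

lemma linear_trace_mult: "linear (\<lambda>X. trace (A ** X))" for A :: "complex^'n^'m"
  unfolding linear_iff by (simp add: matrix_mult.add_right matrix_mult.scaleR_right trace_linear_simps)

lemma bounded_linear_trace_mult: "bounded_linear (\<lambda>X. trace (A ** X))" for A :: "complex^'n^'m"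
  using linear_trace_mult by (simp add: linear_conv_bounded_linear)

lemma smooth_phi: "smooth_on_mfd SU (phi v a)"
  by (rule smooth_on_mfd_cong[OF phi_eq[symmetric] smooth_on_mfd_bounded_linear[OF bounded_linear_trace_mult]])

lemma mfd_deriv_Re_phi:
  assumes "x \<in> SU" "X \<in> SU_tangent x"
  shows "mfd_deriv SU (\<lambda>y. Re (phi v a y)) x X = Re (trace (outer a v ** X))"
  by (rule mfd_deriv_SU_cong[OF _ bounded_linear_imp_has_derivative[OF
        bounded_linear_compose[OF bounded_linear_Re bounded_linear_trace_mult]] assms])
     (simp add: phi_eq)

text \<open>The trace-free part of \<open>- outer a v ** y\<close>. It is real-linear in
  \<open>y\<close>, so the derivative of the gradient field is explicit.\<close>

definition grad_core ::
  "complex^('p::finite + 'q::finite) \<Rightarrow> complex^('p + 'q) \<Rightarrow> ('p, 'q) cmat \<Rightarrow> ('p, 'q) cmat" where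
  "grad_core v a y = mat (trace (outer a v ** y) / of_nat CARD('p + 'q)) - outer a v ** y"

lemma trace_grad_core [simp]: "trace (grad_core v a y) = 0"
  by (simp add: grad_core_def trace_linear_simps trace_mat del: card_sum)

lemma linear_grad_core: "linear (grad_core v a)"
proof -
  have "(r *\<^sub>R t) / c = r *\<^sub>R (t / c)" for r and t c :: complex
    by (simp add: scaleR_conv_of_real)
  then show ?thesis
    unfolding linear_iff grad_core_def
    by (simp add: matrix_mult.add_right matrix_mult.scaleR_right trace_linear_simps add_divide_distrib
        mat_add mat_scaleR scaleR_right_diff_distrib del: card_sum)
qed

lemma mat_mult_mat: "mat c ** mat d = (mat (c * d) :: 'a::semiring_1^'n^'n)"
  by (simp add: vec_eq_iff mat_mult_nth) (simp add: mat_def)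

lemma grad_core_scale: "grad_core v (c *s a) y = mat c ** grad_core v a y"
  by (simp add: grad_core_def trace_outer_vector_scale outer_vector_scale matrix_mult.diff_right
      mat_mult_mat trace_mat_mult del: card_sum flip: matrix_mul_assoc)

text \<open>The two eigenspaces of \<open>iadj\<close> are orthogonal for the real part of the trace
  form.\<close>

lemma Re_trace_su_proj:
  assumes "Z \<in> su_algebra"
  shows "Re (trace (su_proj W ** Z)) = Re (trace (W ** Z))"
proof -
  have "iadj W ** Z = - iadj (Z ** W)"
    using assms by (simp add: su_algebra_iff iadj_mult matrix_mult.minus_right)
  then have "trace (iadj W ** Z) = - cnj (trace (W ** Z))"
    by (simp add: trace_linear_simps trace_iadj trace_mult_commute[of Z])
  then show ?thesis
    by (simp add: su_proj_def matrix_mult.scaleR_left matrix_mult.diff_left trace_linear_simps)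
qed

lemma SU_metric_grad:
  assumes "x \<in> SU" "X \<in> SU_tangent x"
  shows "SU_metric x (x ** su_proj (grad_core v a x)) X = Re (trace (outer a v ** X))"
proof -
  have Z: "iadj x ** X \<in> su_algebra" using assms SU_tangent_iff by blast
  then have "trace (mat c ** (iadj x ** X)) = 0" for c
    by (simp add: trace_mat_mult su_algebra_iff)
  then have "trace (grad_core v a x ** (iadj x ** X)) = - trace (outer a v ** X)"
    by (simp add: grad_core_def matrix_mult.diff_left trace_linear_simps SU_cancel(1)[OF assms(1)]
        flip: matrix_mul_assoc)
  then show ?thesis
    by (simp add: SU_metric_eq[OF assms(1)] SU_cancel(2)[OF assms(1)] Re_trace_su_proj[OF Z])
qed

lemma grad_tangent: "x ** su_proj (grad_core v a x) \<in> SU_tangent x"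
  by (intro SU_tangent_mult su_proj_in_su_algebra) simp

lemma gradient_Re_phi:
  assumes "x \<in> SU"
  shows "gradient SU SU_tangent SU_metric (\<lambda>y. Re (phi v a y)) x = x ** su_proj (grad_core v a x)"
  unfolding gradient_def
proof (rule the_equality)
  show "x ** su_proj (grad_core v a x) \<in> SU_tangent x \<and>
    (\<forall>X\<in>SU_tangent x. SU_metric x (x ** su_proj (grad_core v a x)) X = mfd_deriv SU (\<lambda>y. Re (phi v a y)) x X)"
    using assms by (simp add: grad_tangent SU_metric_grad mfd_deriv_Re_phi)
next
  fix W assume W: "W \<in> SU_tangent x \<and> (\<forall>X\<in>SU_tangent x. SU_metric x W X = mfd_deriv SU (\<lambda>y. Re (phi v a y)) x X)"
  have "W - x ** su_proj (grad_core v a x) = 0"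
  proof (rule SU_metric_nondegenerate[OF assms])
    show "W - x ** su_proj (grad_core v a x) \<in> SU_tangent x"
      using W grad_tangent by (blast intro: subspace_diff[OF subspace_SU_tangent])
    show "SU_metric x (W - x ** su_proj (grad_core v a x)) X = 0" if "X \<in> SU_tangent x" for X
      using W that assms by (simp add: SU_metric_diff SU_metric_grad mfd_deriv_Re_phi)
  qed
  then show "W = x ** su_proj (grad_core v a x)" by simp
qed

lemma cgradient_phi:
  assumes "x \<in> SU"
  shows "cgradient SU SU_tangent SU_metric (phi v a) x =
    (x ** su_proj (grad_core v a x), x ** su_proj (grad_core v ((- \<i>) *s a) x))"
  by (simp only: cgradient_def Im_phi gradient_Re_phi[OF assms])

lemma bounded_linear_su_proj_grad_core: "bounded_linear (\<lambda>y. su_proj (grad_core v a y))"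
  using linear_compose[OF linear_grad_core linear_su_proj]
  by (simp add: o_def linear_conv_bounded_linear)

lemma gradient_Re_phi_in_SU_fields:
  "gradient SU SU_tangent SU_metric (\<lambda>y. Re (phi v a y)) \<in> SU_fields"
  unfolding vector_fields_def
  by (auto simp: gradient_Re_phi grad_tangent intro!: smooth_on_mfd_cong[OF gradient_Re_phi[symmetric]]
      smooth_on_mfd_bounded_bilinear[OF bounded_bilinear_matrix_mult]
      smooth_on_mfd_bounded_linear[OF bounded_linear_ident]
      smooth_on_mfd_bounded_linear[OF bounded_linear_su_proj_grad_core])

text \<open>The product rule gives a term \<open>X ** G\<close>, which the correction in
  \<open>SU_connection\<close> turns into half a commutator. That commutator is fixed by
  \<open>su_proj\<close>, so everything fits under one projection of a map that is complex-linear in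
  \<open>X\<close> once its trivialized form is treated as a free matrix.\<close>

lemma SU_connection_gradient:
  fixes v a :: "complex^('p::finite + 'q::finite)"
  assumes x: "x \<in> SU" and X: "X \<in> SU_tangent x"
  defines "G \<equiv> su_proj (grad_core v a x)"
  shows "SU_connection (gradient SU SU_tangent SU_metric (\<lambda>y. Re (phi v a y))) x X
    = x ** su_proj (grad_core v a X + (1/2) *\<^sub>R (iadj x ** X ** G - G ** (iadj x ** X)))"
proof -
  let ?Y = "gradient SU SU_tangent SU_metric (\<lambda>y. Re (phi v a y))"
  let ?Z = "iadj x ** X"
  have "((\<lambda>y. y ** su_proj (grad_core v a y)) has_derivative
      (\<lambda>h. x ** su_proj (grad_core v a h) + h ** su_proj (grad_core v a x))) (at x within SU)"
    by (intro matrix_mult.FDERIV has_derivative_ident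
        bounded_linear_imp_has_derivative[OF bounded_linear_su_proj_grad_core])
  from mfd_deriv_SU_cong[OF gradient_Re_phi this x X]
  have "mfd_deriv SU ?Y x X = x ** su_proj (grad_core v a X) + x ** (?Z ** G)"
    by (simp add: G_def matrix_mul_assoc SU_inverse[OF x])
  moreover have "?Z ** G - G ** ?Z \<in> su_algebra"
    unfolding G_def using X SU_tangent_iff[OF x] by (intro commutator_in_su_algebra su_proj_in_su_algebra) auto
  then have "su_proj (?Z ** G - G ** ?Z) = ?Z ** G - G ** ?Z" by (rule su_proj_fix)
  moreover have "X ** (iadj x ** ?Y x) = x ** (?Z ** G)" "?Y x ** ?Z = x ** (G ** ?Z)"
    by (simp_all add: gradient_Re_phi[OF x] SU_cancel(2)[OF x] G_def)
       (simp_all add: matrix_mul_assoc SU_inverse[OF x])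
  moreover have "A - (1/2) *\<^sub>R (A + B) = (1/2) *\<^sub>R (A - B)" for A B :: "('p, 'q) cmat"
    by (simp add: algebra_simps flip: scaleR_add_left)
  ultimately show ?thesis
    by (simp add: SU_connection_def su_proj_linear_simps matrix_mult.add_right matrix_mult.scaleR_right
        matrix_mult.diff_right add_diff_eq[symmetric])
qed

section \<open>Real traces over the space of complex matrices\<close>

lemma sum_Basis_vec:
  fixes h :: "('a::euclidean_space)^'n \<Rightarrow> 'b::comm_monoid_add"
  shows "(\<Sum>e\<in>Basis. h e) = (\<Sum>i\<in>UNIV. \<Sum>u\<in>Basis. h (axis i u))"
proof -
  have "inj_on (\<lambda>(i, u). axis i u :: 'a^'n) (UNIV \<times> Basis)"
    by (auto simp: inj_on_def axis_eq_axis)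
  moreover have "(Basis :: ('a^'n) set) = (\<lambda>(i, u). axis i u) ` (UNIV \<times> Basis)"
    by (auto simp: Basis_vec_def)
  ultimately have "bij_betw (\<lambda>(i, u). axis i u :: 'a^'n) (UNIV \<times> Basis) Basis"
    by (simp add: bij_betw_def)
  from sum.reindex_bij_betw[OF this, of h] show ?thesis
    by (simp add: sum.cartesian_product case_prod_unfold)
qed

lemma sum_Basis_cmat:
  fixes h :: "complex^'n^'m \<Rightarrow> 'b::comm_monoid_add"
  shows "(\<Sum>e\<in>Basis. h e) = (\<Sum>i\<in>UNIV. \<Sum>j\<in>UNIV. h (axis i (axis j 1)) + h (axis i (axis j \<i>)))"
  by (simp add: sum_Basis_vec Basis_complex_def)

text \<open>The real trace of the complex-linear \<open>F\<close> is twice the real part of its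
  complex trace, while the antilinear \<open>iadj\<close> part has real trace zero. The factor one
  half in \<open>su_proj\<close> leaves the real part once.\<close>

lemma sum_Basis_su_proj:
  fixes F :: "('p::finite, 'q::finite) cmat \<Rightarrow> ('p, 'q) cmat"
  assumes "\<And>e. F (mat \<i> ** e) = mat \<i> ** F e"
  shows "(\<Sum>e\<in>Basis. su_proj (F e) \<bullet> e) = Re (\<Sum>i\<in>UNIV. \<Sum>j\<in>UNIV. F (axis i (axis j 1)) $ i $ j)"
proof -
  have "su_proj (F (axis i (axis j 1))) \<bullet> axis i (axis j 1) + su_proj (F (axis i (axis j \<i>))) \<bullet> axis i (axis j \<i>)
      = Re (F (axis i (axis j 1)) $ i $ j)" for i j
  proof -
    have "axis i (axis j \<i>) = mat \<i> ** (axis i (axis j 1) :: ('p, 'q) cmat)"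
      by (simp add: vec_eq_iff mat_mult_nth axis_def)
    then have "F (axis i (axis j \<i>)) = mat \<i> ** F (axis i (axis j 1))"
      using assms by simp
    then show ?thesis
      by (simp add: inner_axis su_proj_def iadj_nth mat_mult_nth inner_complex_def field_simps)
  qed
  then show ?thesis by (simp add: sum_Basis_cmat Re_sum)
qed

lemma axis_nth_nth: "axis i w $ m $ l = axis i (w $ l) $ m"
  by (simp add: axis_def)

lemma mult_axis_axis_nth: "(A ** axis i (axis j 1)) $ k $ l = (if l = j then A $ k $ i else 0)"
  for A :: "'a::comm_semiring_1^'n^'m"
proof -
  have "(A ** axis i (axis j 1)) $ k $ l = (\<Sum>m\<in>UNIV. A $ k $ m * axis i (axis j 1 $ l) $ m)"
    by (simp add: matrix_matrix_mult_def axis_nth_nth)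
  then show ?thesis by (simp only: sum_mult_axis) (simp add: axis_def)
qed

lemma axis_axis_mult_nth: "(axis i (axis j 1) ** A) $ k $ l = (if k = i then A $ j $ l else 0)"
  for A :: "'a::comm_semiring_1^'n^'m"
proof -
  have "(axis i (axis j 1) ** A) $ k $ l = (\<Sum>m\<in>UNIV. A $ m $ l * axis j (if k = i then 1 else 0) $ m)"
    unfolding matrix_matrix_mult_def by (auto simp: axis_def intro!: sum.cong)
  then show ?thesis by (simp only: sum_mult_axis) simp
qed

lemma mult_mat_mult: "A ** (mat c ** B) = mat c ** (A ** B)"
  for A :: "'a::comm_semiring_1^'n^'m" and B :: "'a^'k^'n"
  using mat_mult_commute[of c A] by (simp add: matrix_mul_assoc)

lemma divergence_gradient_Re_phi:
  fixes v a :: "complex^('p::finite + 'q::finite)"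
  assumes x: "x \<in> SU"
  defines "n \<equiv> of_nat CARD('p + 'q) :: complex"
  shows "divergence SU SU_tangent SU_metric (gradient SU SU_tangent SU_metric (\<lambda>y. Re (phi v a y))) x
    = Re ((1 / n - n) * phi v a x)"
proof -
  define G where "G = su_proj (grad_core v a x)"
  define M where "M = outer a v ** x"
  define F where "F = (\<lambda>e. grad_core v a (x ** e) + (1/2) *\<^sub>R (e ** G - G ** e))"
  let ?L = "\<lambda>X. x ** su_proj (F (iadj x ** X))"
  have linF: "linear F"
    unfolding F_def linear_iff
    by (simp add: linear_add[OF linear_grad_core] linear_scale[OF linear_grad_core] matrix_mult.add_left
        matrix_mult.add_right matrix_mult.scaleR_left matrix_mult.scaleR_right algebra_simps)
  \<comment> \<open>This makes \<open>?L\<close> map every matrix, tangent or not, into the tangent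
    space, as \<open>trace_on_eq_sum_Basis\<close> demands.\<close>
  have trF: "trace (F e) = 0" for e
    by (simp add: F_def trace_linear_simps trace_mult_commute[of e])
  have "divergence SU SU_tangent SU_metric (gradient SU SU_tangent SU_metric (\<lambda>y. Re (phi v a y))) x
      = trace_on (SU_tangent x) ?L"
    unfolding divergence_SU[OF gradient_Re_phi_in_SU_fields x]
    by (rule trace_on_cong[OF _ subspace_SU_tangent])
       (simp add: SU_connection_gradient[OF x] F_def G_def SU_inverse[OF x] matrix_mul_assoc)
  also have "\<dots> = (\<Sum>e\<in>Basis. (iadj x ** ?L (x ** e)) \<bullet> e)"
  proof (rule trace_on_eq_sum_Basis[OF subspace_SU_tangent])
    show "linear ?L"
      unfolding linear_iff
      by (simp add: matrix_mult.add_right matrix_mult.scaleR_right linear_add[OF linF] linear_scale[OF linF]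
          su_proj_linear_simps)
    show "?L y \<in> SU_tangent x" for y
      by (intro SU_tangent_mult su_proj_in_su_algebra trF)
  qed (simp_all add: SU_cancel[OF x] bounded_linear.linear[OF matrix_mult.bounded_linear_right])
  also have "\<dots> = (\<Sum>e\<in>Basis. su_proj (F e) \<bullet> e)"
    by (simp add: SU_cancel[OF x])
  also have "\<dots> = Re (\<Sum>i\<in>UNIV. \<Sum>j\<in>UNIV. F (axis i (axis j 1)) $ i $ j)"
  proof (rule sum_Basis_su_proj)
    fix e :: "('p, 'q) cmat"
    note c = mult_mat_mult
    have "grad_core v a (mat \<i> ** y) = mat \<i> ** grad_core v a y" for y
      by (simp add: grad_core_def c matrix_mult.diff_right trace_mat_mult mat_mult_mat del: card_sum)
    then show "F (mat \<i> ** e) = mat \<i> ** F e"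
      by (simp add: F_def c matrix_mult.diff_right matrix_mult.add_right matrix_mult.scaleR_right
          flip: matrix_mul_assoc)
  qed
  \<comment> \<open>The complex trace over matrix units: the scalar part contributes
    \<open>trace M / n\<close>, left multiplication by \<open>M\<close> contributes
    \<open>n * trace M\<close>, and the commutator with \<open>G\<close> cancels in the sum.\<close>
  also have "(\<Sum>i\<in>UNIV. \<Sum>j\<in>UNIV. F (axis i (axis j 1)) $ i $ j)
      = (\<Sum>i\<in>UNIV. \<Sum>j\<in>UNIV. (if i = j then M $ j $ i / n else 0) - M $ i $ i + (G $ j $ j - G $ i $ i) / 2)"
  proof (intro sum.cong refl)
    fix i j
    have "trace (M ** axis i (axis j 1)) = M $ j $ i" for i j
      by (simp add: trace_def mult_axis_axis_nth)
    then show "F (axis i (axis j 1)) $ i $ j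
        = (if i = j then M $ j $ i / n else 0) - M $ i $ i + (G $ j $ j - G $ i $ i) / 2"
      by (simp add: F_def grad_core_def matrix_mul_assoc mult_axis_axis_nth axis_axis_mult_nth mat_def n_def
          scaleR_conv_of_real[where 'a = complex] del: card_sum flip: M_def)
  qed
  also have "\<dots> = trace M / n - n * trace M"
    by (simp add: sum.distrib sum_subtractf trace_def n_def sum_divide_distrib[symmetric] del: card_sum
        flip: sum_distrib_left)
  also have "\<dots> = (1 / n - n) * phi v a x"
    by (simp add: phi_eq[OF x] M_def left_diff_distrib)
  finally show ?thesis .
qed

lemma tension_field_phi:
  fixes v a :: "complex^('p::finite + 'q::finite)"
  assumes "x \<in> SU"
  defines "n \<equiv> of_nat CARD('p + 'q) :: complex"
  shows "tension_field SU SU_tangent SU_metric (phi v a) x = (1 / n - n) * phi v a x"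
proof -
  have "tension_field SU SU_tangent SU_metric (phi v a) x =
     Complex (Re ((1 / n - n) * phi v a x)) (Re ((1 / n - n) * phi v ((- \<i>) *s a) x))"
    unfolding tension_field_def cdivergence_def cgradient_def fst_conv snd_conv Im_phi n_def
    by (simp only: divergence_gradient_Re_phi[OF assms(1)])
  moreover have "(1 / n - n) * phi v ((- \<i>) *s a) x = - \<i> * ((1 / n - n) * phi v a x)"
    unfolding phi_scale by (rule mult.left_commute)
  ultimately show ?thesis by (simp only: complex_eq_iff) simp
qed

text \<open>Rank one enters here: the inner factors collapse to a scalar, written as a trace so that
  it becomes a value of \<open>phi\<close>.\<close>

lemma outer_mult_outer: "outer a v ** (A ** outer b w) = mat (trace (outer b v ** A)) ** outer a w"
  for A :: "complex^'n^'m"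
proof -
  have "trace (outer b v ** A) = (\<Sum>k\<in>UNIV. \<Sum>l\<in>UNIV. b $ k * v $ l * A $ l $ k)"
    by (simp add: trace_def outer_def matrix_matrix_mult_def)
  then show ?thesis
    by (subst vec_eq_iff, subst vec_eq_iff) (simp add: mat_mult_nth, simp add: outer_def matrix_matrix_mult_def
        sum_distrib_left sum_distrib_right mult_ac, subst sum.swap, simp)
qed

lemma conformality_phi:
  fixes v a b :: "complex^('p::finite + 'q::finite)"
  assumes x: "x \<in> SU"
  defines "n \<equiv> of_nat CARD('p + 'q) :: complex"
  shows "conformality SU SU_tangent SU_metric (phi v a) (phi v b) x = (1 / n - 1) * phi v a x * phi v b x"
proof -
  define G where "G c = x ** su_proj (grad_core v c x)" for c
  define T where "T X = trace (outer a v ** X)" for X :: "('p, 'q) cmat"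
  have g: "SU_metric x (G c) (G d) = Re (trace (outer c v ** G d))" for c d
    unfolding G_def by (rule SU_metric_grad[OF x grad_tangent])
  \<comment> \<open>Pairing with the gradient of \<open>phi v a\<close> is its differential, so the
    four real terms assemble into the complex differential applied to the complexified gradient of
    \<open>phi v b\<close>.\<close>
  have "conformality SU SU_tangent SU_metric (phi v a) (phi v b) x = T (G b) + \<i> * T (G ((- \<i>) *s b))"
    unfolding conformality_def cmetric_def cgradient_phi[OF x] fst_conv snd_conv G_def[symmetric] g
      trace_outer_vector_scale T_def[symmetric]
    by (simp add: complex_eq_iff)
  also have "\<dots> = T (x ** (su_proj (grad_core v b x) + mat \<i> ** su_proj (- (mat \<i> ** grad_core v b x))))"
  proof -
    have "\<i> * T Y = T (mat \<i> ** Y)" for Y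
      unfolding T_def by (simp add: mult_mat_mult trace_mat_mult)
    then show ?thesis
      unfolding G_def grad_core_scale mat_uminus
      by (simp add: T_def matrix_mult.add_right trace_linear_simps matrix_mult.minus_left mult_mat_mult)
  qed
  also have "\<dots> = T (x ** grad_core v b x)"
    by (simp only: su_proj_decomp)
  also have "\<dots> = (1 / n - 1) * phi v a x * phi v b x"
  proof -
    have 1: "outer a v ** (x ** mat c) = mat c ** (outer a v ** x)" for c
      using mult_mat_mult[of "outer a v ** x" c "mat 1"] by (simp add: matrix_mul_assoc)
    have 2: "outer a v ** (x ** (outer b v ** x)) = mat (trace (outer b v ** x)) ** (outer a v ** x)"
      using arg_cong[OF outer_mult_outer[of a v x b v], of "\<lambda>A. A ** x"] by (simp add: matrix_mul_assoc)
    show ?thesis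
      by (simp add: T_def grad_core_def matrix_mult.diff_right trace_linear_simps 1 2 trace_mat_mult phi_eq[OF x]
          n_def left_diff_distrib del: card_sum)
  qed
  finally show ?thesis .
qed

section \<open>Dimension of the family\<close>

text \<open>If \<open>phi v a\<close> vanishes on the group, the functional \<open>?T\<close>
  vanishes on \<open>su_algebra\<close> by the lines through the identity, then on all trace-free
  matrices by \<open>su_proj_decomp\<close>, and on scalars by its value at the identity. Hence it
  vanishes on every matrix unit.\<close>

lemma inj_phi:
  assumes "v \<noteq> 0"
  shows "inj (phi v)"
proof -
  have "a = 0" if "phi v a = 0" for a
  proof -
    let ?T = "\<lambda>X. trace (outer a v ** X)"
    note lin = linear_add[OF linear_trace_mult] linear_scale[OF linear_trace_mult] linear_diff[OF linear_trace_mult]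
    have 0: "?T x = 0" if "x \<in> SU" for x
      using phi_eq[OF that, of v a] \<open>phi v a = 0\<close> by simp
    have 1: "mat 1 \<in> SU" by (simp add: SU_iff)
    have su: "?T Z = 0" if "Z \<in> su_algebra" for Z
    proof -
      have "Z \<in> span (null_gen ` Collect null_vector)" using that span_null_gen by blast
      then show ?thesis
      proof (induction rule: span_induct_alt)
        case base
        then show ?case by (simp add: trace_linear_simps)
      next
        case (step c y z)
        then obtain \<xi> where \<xi>: "y = null_gen \<xi>" "null_vector \<xi>" by auto
        have "?T (mat 1 + 1 *\<^sub>R (mat 1 ** y)) = 0" by (rule 0) (use SU_line[OF 1 \<xi>(2)] \<xi>(1) in blast)
        then have "?T y = 0" using 0[OF 1] unfolding lin by simp
        then show ?case using step by (simp add: lin)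
      qed
    qed
    have sl: "?T W = 0" if "trace W = 0" for W
    proof -
      have "outer a v ** (mat \<i> ** Y) = mat \<i> ** (outer a v ** Y)" for Y :: "('a, 'b) cmat"
        by (rule mult_mat_mult)
      then have "?T (su_proj W + mat \<i> ** su_proj (- (mat \<i> ** W))) = 0"
        unfolding lin using that
        by (simp add: trace_mat_mult su su_proj_in_su_algebra trace_linear_simps)
      then show ?thesis by (simp only: su_proj_decomp)
    qed
    have "a $ i * v $ j = 0" for i j
    proof -
      let ?E = "axis j (axis i 1) :: ('a, 'b) cmat"
      \<comment> \<open>Splits the matrix unit into a trace-free and a scalar part.\<close>
      let ?c = "trace ?E / of_nat CARD('a + 'b)"
      have "outer a v ** mat c = mat c ** (outer a v ** mat 1)" for c
        by (simp add: mat_mult_commute)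
      then have "?T (mat c) = 0" for c
        using 0[OF 1] by (simp add: trace_mat_mult)
      moreover have "?T (?E - mat ?c) = 0"
        by (rule sl) (simp add: trace_linear_simps trace_mat del: card_sum)
      ultimately have "?T ?E = 0" unfolding lin by simp
      then show ?thesis by (simp add: trace_def mult_axis_axis_nth) (simp add: outer_def)
    qed
    moreover obtain j where "v $ j \<noteq> 0" using assms by (auto simp: vec_eq_iff)
    ultimately show ?thesis by (metis mult_eq_0_iff vec_eq_iff zero_index)
  qed
  then have "a = b" if "phi v a = phi v b" for a b
  proof -
    have "phi v (a + (- 1) *s b) = 0"
      unfolding fun_eq_iff phi_add phi_scale using that by simp
    then have "a + (- 1) *s b = 0" by fact
    then show ?thesis by (simp add: vec_eq_iff)
  qed
  then show ?thesis by (rule injI)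
qed

lemma linear_phi: "Vector_Spaces.linear (*s) fun_scale (phi v)"
  unfolding Vector_Spaces.linear_iff
  using vec.vector_space_axioms vector_space_fun_scale
  by (auto simp: fun_eq_iff fun_scale_def phi_add phi_scale)

theorem theorem15p2:
  fixes v :: "complex^('p::finite + 'q::finite)"
    and n :: nat
  assumes "n = CARD('p) + CARD('q)"
    and "v \<noteq> 0"
  shows "module.subspace fun_scale (eigen_space v)
    \<and> vector_space.dim fun_scale (eigen_space v) = n
    \<and> eigenfamily SU SU_tangent SU_metric (eigen_space v)
    \<and> (\<forall>\<phi>\<in>eigen_space v. \<forall>z\<in>SU.
         tension_field SU SU_tangent SU_metric \<phi> z = - (((of_nat n)\<^sup>2 - 1) / of_nat n) * \<phi> z)
    \<and> (\<forall>\<phi>\<in>eigen_space v. \<forall>\<psi>\<in>eigen_space v. \<forall>z\<in>SU.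
         conformality SU SU_tangent SU_metric \<phi> \<psi> z = - ((of_nat n - 1) / of_nat n) * \<phi> z * \<psi> z)"
proof -
  interpret F: vector_space fun_scale by (rule vector_space_fun_scale)
  \<comment> \<open>Only the parameter space is taken as finite-dimensional; the dimension of the
    family comes from the injective linear map \<open>phi v\<close>.\<close>
  interpret P: finite_dimensional_vector_space_pair_1 "(*s)" cart_basis
      "fun_scale :: complex \<Rightarrow> (('p, 'q) cmat \<Rightarrow> complex) \<Rightarrow> _"
    by unfold_locales
  have n: "n = CARD('p + 'q)" using assms(1) by simp
  have n0: "(of_nat n :: complex) \<noteq> 0" unfolding n of_nat_eq_0_iff by simp
  have subspace: "F.subspace (eigen_space v)"
    unfolding eigen_space_def by (rule P.linear_subspace_image[OF linear_phi vec.subspace_UNIV])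
  have dim: "F.dim (eigen_space v) = n"
  proof -
    have "F.dim (range (phi v)) = vec.dim (UNIV :: (complex^('p + 'q)) set)"
      by (rule P.dim_image_eq[OF linear_phi]) (use inj_phi[OF assms(2)] in \<open>auto intro: inj_on_subset\<close>)
    then show ?thesis by (simp add: eigen_space_def n card_cart_basis del: card_sum)
  qed
  have tension: "tension_field SU SU_tangent SU_metric \<phi> z = - (((of_nat n)\<^sup>2 - 1) / of_nat n) * \<phi> z"
    if "\<phi> \<in> eigen_space v" "z \<in> SU" for \<phi> z
  proof -
    have "1 / of_nat n - of_nat n = - (((of_nat n)\<^sup>2 - 1) / of_nat n :: complex)"
      using n0 by (simp add: field_simps power2_eq_square)
    then show ?thesis
      using that tension_field_phi[OF that(2), of v] unfolding eigen_space_def n[symmetric] by auto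
  qed
  have conf: "conformality SU SU_tangent SU_metric \<phi> \<psi> z = - ((of_nat n - 1) / of_nat n) * \<phi> z * \<psi> z"
    if "\<phi> \<in> eigen_space v" "\<psi> \<in> eigen_space v" "z \<in> SU" for \<phi> \<psi> z
  proof -
    have "1 / of_nat n - 1 = - ((of_nat n - 1) / of_nat n :: complex)"
      using n0 by (simp add: field_simps)
    then show ?thesis
      using that conformality_phi[OF that(3), of v] unfolding eigen_space_def n[symmetric] by auto
  qed
  have "eigenfamily SU SU_tangent SU_metric (eigen_space v)"
    unfolding eigenfamily_def
  proof (intro conjI exI ballI)
    show "smooth_on_mfd SU \<phi>" if "\<phi> \<in> eigen_space v" for \<phi>
      using that smooth_phi unfolding eigen_space_def by blast
  qed (rule tension conf; assumption)+
  then show ?thesis using subspace dim tension conf by blast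
qed

end
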